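(* The sets $\mathcal K^+_{\alpha,\beta}$ and $\mathcal K^-_{\alpha,\beta}$ do not depend on $(\alpha,\beta)$ as long as $(\alpha,\beta)\in\Omega$; that is, for all $(\alpha,\beta),(\alpha',\beta')\in\Omega$, $\mathcal K^+_{\alpha,\beta}=\mathcal K^+_{\alpha',\beta'}$ and $\mathcal K^-_{\alpha,\beta}=\mathcal K^-_{\alpha',\beta'}$.
   Context: Functions are complex-valued on $\mathbb R^4$. $E(\varphi)=\int_{\mathbb R^4}\left[\frac12|\nabla\varphi|^2-\frac14|\varphi|^4+\frac3{10}|\varphi|^{10/3}\right]dx$. $\Omega=\{(\alpha,\beta)\in\mathbb R^2:\alpha\ge0,\ 5\alpha+6\beta\ge0,\ (\alpha,\beta)\ne(0,0)\}$. For $(\alpha,\beta)\in\Omega$ and $\varphi\in H^1(\mathbb R^4)$, $$K_{\alpha,\beta}(\varphi)=(\alpha+\beta)\int_{\mathbb R^4}\left[|\nabla\varphi|^2-|\varphi|^4\right]dx+\Big(\alpha+\frac65\beta\Big)\int_{\mathbb R^4}|\varphi|^{10/3}dx,$$ $m_{\alpha,\beta}=\inf\{E(\varphi):\varphi\in H^1(\mathbb R^4)\setminus\{0\},\ K_{\alpha,\beta}(\varphi)=0\}$, $\mathcal K^+_{\alpha,\beta}=\{\varphi\in H^1(\mathbb R^4):E(\varphi)<m_{\alpha,\beta},\ K_{\alpha,\beta}(\varphi)\ge0\}$, $\mathcal K^-_{\alpha,\beta}=\{\varphi\in H^1(\mathbb R^4):E(\varphi)<m_{\alpha,\beta},\ K_{\alpha,\beta}(\varphi)<0\}$.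 *)

theory Defs
  imports "HOL-Analysis.Analysis"
begin

section \<open>Test functions and weak gradients\<close>

definition partial_deriv :: "'n::finite \<Rightarrow> (real^'n \<Rightarrow> real) \<Rightarrow> real^'n \<Rightarrow> real" where
  "partial_deriv i f x = frechet_derivative f (at x) (axis i 1)"

text \<open>All iterated partial derivatives exist and are (Frechet) differentiable everywhere;
  since differentiability gives continuity, this is the class \<open>C\<^sup>\<infinity>\<close>.\<close>

definition smooth_fun :: "(real^'n::finite \<Rightarrow> real) \<Rightarrow> bool" where
  "smooth_fun f \<longleftrightarrow> (\<forall>is x. (foldr partial_deriv is f) differentiable (at x))"

definition test_fun :: "(real^'n::finite \<Rightarrow> real) \<Rightarrow> bool" where
  "test_fun \<psi> \<longleftrightarrow> smooth_fun \<psi> \<and> compact (closure {x. \<psi> x \<noteq> 0})"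

definition locally_integrable :: "('a::euclidean_space \<Rightarrow> 'b::euclidean_space) \<Rightarrow> bool" where
  "locally_integrable f \<longleftrightarrow> (\<forall>C. compact C \<longrightarrow> set_integrable lebesgue C f)"

text \<open>Real-valued test functions suffice for complex-valued \<open>f\<close>, by linearity.
  Local integrability makes all the integrals below converge.\<close>

definition has_weak_gradient ::
    "(real^'n::finite \<Rightarrow> complex) \<Rightarrow> (real^'n \<Rightarrow> complex^'n) \<Rightarrow> bool" where
  "has_weak_gradient f g \<longleftrightarrow>
     locally_integrable f \<and> locally_integrable g \<and>
     (\<forall>\<psi> i. test_fun \<psi> \<longrightarrow>
        (LINT x|lebesgue. partial_deriv i \<psi> x *\<^sub>R f x) = - (LINT x|lebesgue. \<psi> x *\<^sub>R (g x $ i)))"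

text \<open>Weak gradients are unique up to null sets, so integrals do not depend on the choice.\<close>

definition weak_gradient :: "(real^'n::finite \<Rightarrow> complex) \<Rightarrow> real^'n \<Rightarrow> complex^'n" where
  "weak_gradient f = (SOME g. has_weak_gradient f g)"

definition square_integrable :: "('a::euclidean_space \<Rightarrow> 'b::euclidean_space) \<Rightarrow> bool" where
  "square_integrable f \<longleftrightarrow>
     f \<in> borel_measurable lebesgue \<and> integrable lebesgue (\<lambda>x. (norm (f x))\<^sup>2)"

text \<open>Elements of \<open>H\<^sup>1\<close> are represented by functions: \<open>H1\<close> contains every representative of every
  class modulo almost-everywhere equality. The zero element is thus the set of functions
  vanishing almost everywhere.\<close>

definition H1 :: "(real^'n::finite \<Rightarrow> complex) set" where
  "H1 = {f. square_integrable f \<and> (\<exists>g. has_weak_gradient f g \<and> square_integrable g)}"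

section \<open>The functionals and the variational problem\<close>

text \<open>All integrals below converge for \<open>\<phi> \<in> H1\<close>, since \<open>H\<^sup>1(\<real>\<^sup>4)\<close> embeds into
  \<open>L\<^sup>p(\<real>\<^sup>4)\<close> for \<open>2 \<le> p \<le> 4\<close>.\<close>

definition energy :: "(real^4 \<Rightarrow> complex) \<Rightarrow> real" where
  "energy \<phi> = (LINT x|lebesgue.
      1/2 * (norm (weak_gradient \<phi> x))\<^sup>2 - 1/4 * norm (\<phi> x) ^ 4
        + 3/10 * norm (\<phi> x) powr (10/3))"

definition Omega :: "(real \<times> real) set" where
  "Omega = {(\<alpha>, \<beta>). \<alpha> \<ge> 0 \<and> 5 * \<alpha> + 6 * \<beta> \<ge> 0 \<and> (\<alpha>, \<beta>) \<noteq> (0, 0)}"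

definition K_fun :: "real \<Rightarrow> real \<Rightarrow> (real^4 \<Rightarrow> complex) \<Rightarrow> real" where
  "K_fun \<alpha> \<beta> \<phi> =
     (\<alpha> + \<beta>) * (LINT x|lebesgue. (norm (weak_gradient \<phi> x))\<^sup>2 - norm (\<phi> x) ^ 4)
     + (\<alpha> + 6/5 * \<beta>) * (LINT x|lebesgue. norm (\<phi> x) powr (10/3))"

text \<open>The infimum is taken in the extended reals, so that no separate argument is needed for
  non-emptiness and boundedness from below.\<close>

definition m_inf :: "real \<Rightarrow> real \<Rightarrow> ereal" where
  "m_inf \<alpha> \<beta> =
     (INF \<phi> \<in> {\<phi> \<in> H1. \<not> (AE x in lebesgue. \<phi> x = 0) \<and> K_fun \<alpha> \<beta> \<phi> = 0}. ereal (energy \<phi>))"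

definition K_plus :: "real \<Rightarrow> real \<Rightarrow> (real^4 \<Rightarrow> complex) set" where
  "K_plus \<alpha> \<beta> = {\<phi> \<in> H1. ereal (energy \<phi>) < m_inf \<alpha> \<beta> \<and> K_fun \<alpha> \<beta> \<phi> \<ge> 0}"

definition K_minus :: "real \<Rightarrow> real \<Rightarrow> (real^4 \<Rightarrow> complex) set" where
  "K_minus \<alpha> \<beta> = {\<phi> \<in> H1. ereal (energy \<phi>) < m_inf \<alpha> \<beta> \<and> K_fun \<alpha> \<beta> \<phi> < 0}"

end

theory Submission
  imports Defs
begin

text \<open>Write \<open>G\<close>, \<open>P\<close>, \<open>Q\<close> for the integrals of \<open>|\<nabla>\<phi>|\<^sup>2\<close>, \<open>|\<phi>|\<^sup>4\<close>, \<open>|\<phi>|\<close> to the power \<open>10/3\<close>. Amplitude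
  and dilation scaling replace \<open>(G, P, Q)\<close> by \<open>(sG, s\<^sup>2P, tQ)\<close> for arbitrary \<open>s, t > 0\<close>. On
  \<open>K \<ge> 0\<close> one has \<open>E \<ge> G/4\<close>, and \<open>K = 0\<close> also forces \<open>G \<le> P\<close>; conversely a scaling with \<open>s\<close> just
  above \<open>G/P\<close> and \<open>t\<close> small satisfies \<open>K = 0\<close> with energy close to \<open>G\<^sup>2/(4P)\<close>. Hence every
  \<open>m_inf \<alpha> \<beta>\<close> is the infimum of \<open>G\<^sup>2/(4P)\<close>. If \<open>E\<close> is below this level and \<open>K \<ge> 0\<close>
  for one pair of parameters, then \<open>G/4 < G\<^sup>2/(4P)\<close>, so \<open>P < G\<close> and \<open>K \<ge> 0\<close> for all of them.

  The Sobolev embedding is not used. The only question is what happens for \<open>\<phi> \<in> H\<^sup>1\<close>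
  outside \<open>L\<^sup>4\<close>, where the energy integral has the junk value 0: mollifying such a \<open>\<phi>\<close> keeps \<open>G\<close> bounded
  while \<open>P\<close> tends to infinity, so its existence would force the infimum to be at most 0.\<close>


section \<open>Smooth bump functions\<close>

text \<open>In dimension 4 an amplitude a and a dilation b multiply G by (a/b)^2, P by (a/b)^4 and Q
  by a^(10/3)/b^4. So G^2/P is invariant while Q can be made small on its own, which is why the
  parameters leave no trace in the level. A positive lower bound for G^2/P is exactly the critical
  Sobolev inequality, and the argument is a dichotomy on it: if it holds for finite P, it extends to
  all of H^1 and nothing lies outside L^4; if it fails, the junk energy 0 is not below the level.

  Most of the work makes G usable. \<open>weak_gradient\<close> is an arbitrary choice, so the
  gradient integral of a scaled or mollified function can be computed only once weak gradients are
  known to be unique almost everywhere. That needs compactly supported smooth kernels, hence the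
  bump functions. The strict inequalities also need G > 0 for nonzero functions: a vanishing weak
  gradient must force an L^2 function to vanish. Convolution and Fubini are carried out for Borel
  functions, so Lebesgue measurable functions are first replaced by Borel representatives.\<close>

primrec times_differentiable :: "nat \<Rightarrow> (real \<Rightarrow> real) \<Rightarrow> bool" where
  "times_differentiable 0 f \<longleftrightarrow> True"
| "times_differentiable (Suc n) f \<longleftrightarrow>
     (\<exists>f'. (\<forall>x. (f has_real_derivative f' x) (at x)) \<and> times_differentiable n f')"

definition smooth_real :: "(real \<Rightarrow> real) \<Rightarrow> bool" where
  "smooth_real f \<longleftrightarrow> (\<forall>n. times_differentiable n f)"

lemma times_differentiable_SucD: "times_differentiable (Suc n) f \<Longrightarrow> times_differentiable n f"
  by (induction n arbitrary: f) auto

lemma times_differentiable_add: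
  "times_differentiable n f \<Longrightarrow> times_differentiable n g \<Longrightarrow> times_differentiable n (\<lambda>x. f x + g x)"
proof (induction n arbitrary: f g)
  case (Suc n)
  then obtain f' g' where "\<forall>x. (f has_real_derivative f' x) (at x)" "times_differentiable n f'"
    "\<forall>x. (g has_real_derivative g' x) (at x)" "times_differentiable n g'"
    by auto
  with Suc.IH[of f' g'] show ?case
    by (auto intro!: exI[of _ "\<lambda>x. f' x + g' x"] derivative_eq_intros)
qed auto

lemma times_differentiable_mult:
  "times_differentiable n f \<Longrightarrow> times_differentiable n g \<Longrightarrow> times_differentiable n (\<lambda>x. f x * g x)"
proof (induction n arbitrary: f g)
  case (Suc n)
  then obtain f' g' where *: "\<forall>x. (f has_real_derivative f' x) (at x)" "times_differentiable n f'"
    "\<forall>x. (g has_real_derivative g' x) (at x)" "times_differentiable n g'"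
    by auto
  have "times_differentiable n (\<lambda>x. f' x * g x + f x * g' x)"
    using * Suc.prems[THEN times_differentiable_SucD] by (intro times_differentiable_add Suc.IH)
  with * show ?case
    by (auto intro!: exI[of _ "\<lambda>x. f' x * g x + f x * g' x"] derivative_eq_intros)
qed auto

lemma times_differentiable_const: "times_differentiable n (\<lambda>x. c)"
  by (induction n arbitrary: c) (auto intro!: exI[of _ "\<lambda>x. 0"])

lemma times_differentiable_affine:
  "times_differentiable n f \<Longrightarrow> times_differentiable n (\<lambda>x. f (a + b * x))"
proof (induction n arbitrary: f)
  case (Suc n)
  then obtain f' where f': "\<forall>x. (f has_real_derivative f' x) (at x)" "times_differentiable n f'"
    by auto
  have "((\<lambda>x. f (a + b * x)) has_real_derivative b * f' (a + b * x)) (at x)" for x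
    by (rule DERIV_chain2[THEN DERIV_cong], rule f'(1)[rule_format])
       (auto intro!: derivative_eq_intros)
  moreover have "times_differentiable n (\<lambda>x. b * f' (a + b * x))"
    using f' by (intro times_differentiable_mult times_differentiable_const Suc.IH)
  ultimately show ?case by (auto intro!: exI[of _ "\<lambda>x. b * f' (a + b * x)"])
qed auto

lemma smooth_real_mult: "smooth_real f \<Longrightarrow> smooth_real g \<Longrightarrow> smooth_real (\<lambda>x. f x * g x)"
  and smooth_real_add: "smooth_real f \<Longrightarrow> smooth_real g \<Longrightarrow> smooth_real (\<lambda>x. f x + g x)"
  and smooth_real_affine: "smooth_real f \<Longrightarrow> smooth_real (\<lambda>x. f (a + b * x))"
  and smooth_real_const: "smooth_real (\<lambda>x. c)"
  by (auto simp: smooth_real_def intro: times_differentiable_mult times_differentiable_add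
      times_differentiable_affine times_differentiable_const)

text \<open>\<open>times_differentiable\<close> offers a possibly different derivative witness at
  each order. Uniqueness of derivatives identifies all of them with \<open>deriv f\<close>, so
  smoothness passes to \<open>deriv f\<close> at every order at once.\<close>

lemma smooth_real_derivD:
  assumes "smooth_real f"
  shows "(f has_real_derivative deriv f x) (at x)" "smooth_real (deriv f)"
proof -
  have *: "(\<forall>x. (f has_real_derivative deriv f x) (at x)) \<and> times_differentiable n (deriv f)" for n
  proof -
    obtain f' where f': "\<forall>x. (f has_real_derivative f' x) (at x)" "times_differentiable n f'"
      using assms unfolding smooth_real_def by (metis times_differentiable.simps(2))
    then have "deriv f = f'"
      by (auto intro: DERIV_imp_deriv)
    with f' show ?thesis by auto
  qed
  show "(f has_real_derivative deriv f x) (at x)" "smooth_real (deriv f)"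
    using * by (auto simp: smooth_real_def)
qed

lemma smooth_real_primitive:
  assumes "smooth_real f" "\<And>x. (F has_real_derivative f x) (at x)"
  shows "smooth_real F"
  unfolding smooth_real_def
proof
  fix n show "times_differentiable n F"
    using assms by (cases n) (auto simp: smooth_real_def)
qed

text \<open>For \<open>k = 0\<close> this is the classical flat function exp(-1/t). The powers of
  1/t are included because the linear span of the family is closed under differentiation, which is
  what the induction on the order needs.\<close>

definition flat_exp :: "nat \<Rightarrow> real \<Rightarrow> real" where
  "flat_exp k t = (if 0 < t then inverse t ^ k * exp (- inverse t) else 0)"

lemma flat_exp_tendsto_0: "(flat_exp k \<longlongrightarrow> 0) (at_right 0)"
proof -
  have "((\<lambda>t. inverse t ^ k / exp (inverse t)) \<longlongrightarrow> (0::real)) (at_right 0)"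
    by (rule filterlim_compose[OF tendsto_power_div_exp_0 filterlim_inverse_at_top_right])
  then show ?thesis
    by (rule Lim_transform_eventually)
       (auto simp: eventually_at_right_field flat_exp_def exp_minus field_simps intro!: exI[of _ 1])
qed

lemma flat_exp_deriv:
  "(flat_exp k has_real_derivative (- real k * flat_exp (Suc k) t + flat_exp (k + 2) t)) (at t)"
proof (cases t "0::real" rule: linorder_cases)
  case less
  have "((\<lambda>t::real. 0) has_real_derivative 0) (at t)" by simp
  then have "(flat_exp k has_real_derivative 0) (at t)"
    by (rule DERIV_cong_ev[THEN iffD1, rotated 3])
       (use less in \<open>auto simp: flat_exp_def intro!: eventually_mono[OF eventually_nhds_in_open[of "{..<0}" t]]\<close>)
  with less show ?thesis by (simp add: flat_exp_def)
next
  case greater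
  have "((\<lambda>t. inverse t ^ k * exp (- inverse t)) has_real_derivative
     (- real k * (inverse t ^ Suc k * exp (- inverse t)) + inverse t ^ (k + 2) * exp (- inverse t))) (at t)"
    using greater
    by (auto intro!: derivative_eq_intros simp: algebra_simps)
       (cases k; simp add: field_simps)
  then have "(flat_exp k has_real_derivative
     (- real k * (inverse t ^ Suc k * exp (- inverse t)) + inverse t ^ (k + 2) * exp (- inverse t))) (at t)"
    by (rule DERIV_cong_ev[THEN iffD1, rotated 3])
       (use greater in \<open>auto simp: flat_exp_def intro!: eventually_mono[OF eventually_nhds_in_open[of "{0<..}" t]]\<close>)
  with greater show ?thesis by (simp add: flat_exp_def)
next
  case equal
  have "((\<lambda>h. (flat_exp k h - flat_exp k 0) / (h - 0)) \<longlongrightarrow> 0) (at 0)"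
  proof (subst filterlim_at_split, intro conjI)
    show "((\<lambda>h. (flat_exp k h - flat_exp k 0) / (h - 0)) \<longlongrightarrow> 0) (at_left 0)"
      by (rule tendsto_eventually)
         (auto simp: eventually_at_left_field flat_exp_def intro!: exI[of _ "-1"])
    \<comment> \<open>For h > 0 the difference quotient at 0 is exactly
      \<open>flat_exp (Suc k) h\<close>, so differentiability at the origin reduces to the limit
      already known for the next index.\<close>
    show "((\<lambda>h. (flat_exp k h - flat_exp k 0) / (h - 0)) \<longlongrightarrow> 0) (at_right 0)"
      by (rule Lim_transform_eventually[OF flat_exp_tendsto_0[of "Suc k"]])
         (auto simp: eventually_at_right_field flat_exp_def field_simps intro!: exI[of _ 1])
  qed
  then show ?thesis
    using equal by (simp add: has_field_derivative_iff flat_exp_def)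
qed

lemma smooth_flat_exp: "smooth_real (flat_exp k)"
proof -
  have "times_differentiable n (flat_exp k)" for n
  proof (induction n arbitrary: k)
    case (Suc n)
    have "times_differentiable n (\<lambda>t. - real k * flat_exp (Suc k) t + flat_exp (k + 2) t)"
      by (intro times_differentiable_add times_differentiable_mult times_differentiable_const Suc)
    then show ?case
      unfolding times_differentiable.simps(2) using flat_exp_deriv[of k] by (intro exI conjI allI)
  qed auto
  then show ?thesis by (simp add: smooth_real_def)
qed

definition bump :: "real \<Rightarrow> real" where
  "bump t = flat_exp 0 (1 + t) * flat_exp 0 (1 - t)"

lemma smooth_bump: "smooth_real bump"
  using smooth_real_mult[OF smooth_real_affine[OF smooth_flat_exp, of 0 1 1]
      smooth_real_affine[OF smooth_flat_exp, of 0 1 "-1"]]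
  by (simp add: bump_def[abs_def])

lemma bump_nonneg: "0 \<le> bump t"
  by (simp add: bump_def flat_exp_def)

lemma bump_pos: "\<bar>t\<bar> < 1 \<Longrightarrow> 0 < bump t"
  by (simp add: bump_def flat_exp_def abs_less_iff)

lemma bump_eq_0: "1 \<le> \<bar>t\<bar> \<Longrightarrow> bump t = 0"
  by (auto simp: bump_def flat_exp_def abs_if split: if_splits)

lemma smooth_real_continuous: "smooth_real f \<Longrightarrow> continuous_on UNIV f"
  by (meson DERIV_continuous continuous_at_imp_continuous_on smooth_real_derivD(1))

section \<open>Tensor products of one-variable functions as test functions\<close>

definition coord_prod :: "('n::finite \<Rightarrow> real \<Rightarrow> real) \<Rightarrow> real^'n \<Rightarrow> real" where
  "coord_prod h x = (\<Prod>j\<in>UNIV. h j (x $ j))"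

lemma has_derivative_coord_prod:
  fixes h :: "'n::finite \<Rightarrow> real \<Rightarrow> real"
  assumes "\<And>j t. (h j has_real_derivative h' j t) (at t)"
  shows "(coord_prod h has_derivative
     (\<lambda>y. \<Sum>j\<in>UNIV. h' j (x $ j) * y $ j * (\<Prod>k\<in>UNIV - {j}. h k (x $ k)))) (at x)"
  unfolding coord_prod_def[abs_def]
proof (rule has_derivative_prod)
  fix j :: 'n
  have "((\<lambda>x. x $ j) has_derivative (\<lambda>y. y $ j)) (at x)"
    by (rule bounded_linear.has_derivative[OF bounded_linear_vec_nth has_derivative_ident])
  from has_derivative_compose[OF this assms[of j, unfolded has_field_derivative_def]]
  show "((\<lambda>x. h j (x $ j)) has_derivative (\<lambda>y. h' j (x $ j) * y $ j)) (at x)"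
    by simp
qed

text \<open>This is the reason for using product bumps: a partial derivative replaces a single
  factor, so the class is stable under iteration and smoothness in several variables reduces to
  smoothness in one.\<close>

lemma partial_deriv_coord_prod:
  assumes "\<And>j t. (h j has_real_derivative h' j t) (at t)"
  shows "partial_deriv i (coord_prod h) = coord_prod (h(i := h' i))"
proof
  fix x
  have "partial_deriv i (coord_prod h) x =
      (\<Sum>j\<in>UNIV. h' j (x $ j) * axis i 1 $ j * (\<Prod>k\<in>UNIV - {j}. h k (x $ k)))"
    unfolding partial_deriv_def
    by (subst frechet_derivative_at[OF has_derivative_coord_prod[OF assms], symmetric]) simp
  also have "\<dots> = (\<Sum>j\<in>UNIV. if j = i then h' i (x $ i) * (\<Prod>k\<in>UNIV - {i}. h k (x $ k)) else 0)"
    by (intro sum.cong) (auto simp: axis_def)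
  also have "\<dots> = coord_prod (h(i := h' i)) x"
    by (auto simp: coord_prod_def prod.remove[of UNIV i] intro!: prod.cong)
  finally show "partial_deriv i (coord_prod h) x = coord_prod (h(i := h' i)) x" .
qed

lemma foldr_partial_deriv_coord_prod:
  assumes "\<And>j. smooth_real (h j)"
  shows "\<exists>h'. (\<forall>j. smooth_real (h' j)) \<and> foldr partial_deriv is (coord_prod h) = coord_prod h'"
proof (induction "is")
  case (Cons i "is")
  then obtain h' where h': "\<And>j. smooth_real (h' j)"
      "foldr partial_deriv is (coord_prod h) = coord_prod h'" by auto
  have "partial_deriv i (coord_prod h') = coord_prod (h'(i := deriv (h' i)))"
    by (rule partial_deriv_coord_prod) (intro smooth_real_derivD h')
  with h' show ?case
    by (intro exI[of _ "h'(i := deriv (h' i))"]) (auto simp del: fun_upd_apply, auto intro: smooth_real_derivD)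
qed (use assms in auto)

lemma smooth_coord_prod:
  assumes "\<And>j. smooth_real (h j)"
  shows "smooth_fun (coord_prod h)"
  unfolding smooth_fun_def
proof (intro allI)
  fix "is" x
  obtain h' where h': "\<And>j. smooth_real (h' j)"
      "foldr partial_deriv is (coord_prod h) = coord_prod h'"
    using foldr_partial_deriv_coord_prod[of h "is", OF assms] by blast
  show "foldr partial_deriv is (coord_prod h) differentiable at x"
    using has_derivative_coord_prod[of h' "\<lambda>j. deriv (h' j)", OF smooth_real_derivD(1)[OF h'(1)]] h'(2)
    by (auto simp: differentiable_def)
qed

text \<open>A nonzero product confines every coordinate to [-R, R]. Bounding the norm by the sum of
  the absolute coordinates then produces the factor \<open>CARD('n)\<close>.\<close>

lemma coord_prod_eq_0_norm:
  assumes "\<And>j t. R < \<bar>t\<bar> \<Longrightarrow> h j t = 0" and "real CARD('n) * R < norm (x::real^'n)"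
  shows "coord_prod h x = 0"
proof (rule ccontr)
  assume "coord_prod h x \<noteq> 0"
  then have "\<bar>x $ j\<bar> \<le> R" for j
    using assms(1)[of "x $ j" j] by (auto simp: coord_prod_def prod_zero_iff) (meson linorder_not_le)
  then have "(\<Sum>j\<in>UNIV. \<bar>x $ j\<bar>) \<le> real CARD('n) * R"
    using sum_bounded_above[of UNIV "\<lambda>j. \<bar>x $ j\<bar>" R] by simp
  with norm_le_l1_cart[of x] assms(2) show False by simp
qed

lemma compact_closure_support:
  assumes "\<And>x. R < norm x \<Longrightarrow> f x = 0"
  shows "compact (closure {x::'a::euclidean_space. f x \<noteq> 0})"
proof -
  have "bounded {x. f x \<noteq> 0}"
    using assms by (intro boundedI[of _ R]) (meson linorder_not_le mem_Collect_eq)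
  then show ?thesis by (simp add: compact_eq_bounded_closed bounded_closure)
qed

lemma test_fun_coord_prod:
  fixes h :: "'n::finite \<Rightarrow> real \<Rightarrow> real"
  assumes "\<And>j. smooth_real (h j)" "\<And>j t. R < \<bar>t\<bar> \<Longrightarrow> h j t = 0"
  shows "test_fun (coord_prod h)"
  unfolding test_fun_def
  using smooth_coord_prod[OF assms(1)] compact_closure_support[OF coord_prod_eq_0_norm[OF assms(2)]]
  by auto

section \<open>Affine changes of variables and continuity of translations\<close>

lemma lebesgue_scale_translate:
  fixes t :: "'a::euclidean_space"
  assumes "c \<noteq> 0"
  shows "lebesgue = density (distr lebesgue lebesgue (\<lambda>x. t + c *\<^sub>R x)) (\<lambda>_. \<bar>c\<bar> ^ DIM('a))"
    and measurable_lebesgue_scale_translate: "(\<lambda>x. t + c *\<^sub>R x) \<in> lebesgue \<rightarrow>\<^sub>M lebesgue"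
proof -
  have *: "(\<Sum>j\<in>Basis. (c * (x \<bullet> j)) *\<^sub>R j) = c *\<^sub>R x" for x :: 'a
    unfolding scaleR_scaleR[symmetric] scaleR_sum_right[symmetric] euclidean_representation ..
  show "lebesgue = density (distr lebesgue lebesgue (\<lambda>x. t + c *\<^sub>R x)) (\<lambda>_. \<bar>c\<bar> ^ DIM('a))"
    using lebesgue_affine_euclidean[of "\<lambda>_. c" t] assms by (simp add: *)
  show "(\<lambda>x. t + c *\<^sub>R x) \<in> lebesgue \<rightarrow>\<^sub>M lebesgue"
    using lebesgue_affine_measurable[of "\<lambda>_. c" t] assms by (simp add: *)
qed

lemma borel_measurable_lebesgue_affine:
  fixes t :: "'a::euclidean_space"
  assumes "c \<noteq> 0" "f \<in> borel_measurable lebesgue"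
  shows "(\<lambda>x. f (t + c *\<^sub>R x)) \<in> borel_measurable lebesgue"
  by (rule measurable_compose[OF measurable_lebesgue_scale_translate[OF assms(1)] assms(2)])

lemma nn_integral_lebesgue_affine:
  fixes t :: "'a::euclidean_space"
  assumes c: "c \<noteq> 0" and f: "f \<in> borel_measurable lebesgue"
  shows "(\<integral>\<^sup>+x. f x \<partial>lebesgue) = ennreal (\<bar>c\<bar> ^ DIM('a)) * (\<integral>\<^sup>+x. f (t + c *\<^sub>R x) \<partial>lebesgue)"
proof -
  note m = measurable_lebesgue_scale_translate[OF c, of t]
  show ?thesis
    using f borel_measurable_lebesgue_affine[OF c f, of t]
    by (subst lebesgue_scale_translate(1)[OF c, of t])
       (simp add: nn_integral_density nn_integral_distr[OF m] nn_integral_cmult del: ennreal_power)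
qed

lemma integrable_lebesgue_affine_iff:
  fixes t :: "'a::euclidean_space" and f :: "'a \<Rightarrow> 'b::{banach, second_countable_topology}"
  assumes c: "c \<noteq> 0" and f: "f \<in> borel_measurable lebesgue"
  shows "integrable lebesgue (\<lambda>x. f (t + c *\<^sub>R x)) \<longleftrightarrow> integrable lebesgue f"
  using f borel_measurable_lebesgue_affine[OF c f, of t] c
    nn_integral_lebesgue_affine[OF c, of "\<lambda>x. ennreal (norm (f x))" t]
  by (auto simp: integrable_iff_bounded ennreal_mult_less_top power_less_top_ennreal)

lemma integral_lebesgue_affine:
  fixes t :: "'a::euclidean_space" and f :: "'a \<Rightarrow> 'b::{banach, second_countable_topology}"
  assumes c: "c \<noteq> 0" and f: "f \<in> borel_measurable lebesgue"
  shows "(\<integral>x. f x \<partial>lebesgue) = \<bar>c\<bar> ^ DIM('a) *\<^sub>R (\<integral>x. f (t + c *\<^sub>R x) \<partial>lebesgue)"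
proof -
  note m = measurable_lebesgue_scale_translate[OF c, of t]
  show ?thesis
    using f borel_measurable_lebesgue_affine[OF c f, of t]
    by (subst lebesgue_scale_translate(1)[OF c, of t])
       (simp add: integral_density integral_distr[OF m])
qed

lemma integral_lborel_affine:
  fixes t :: "'a::euclidean_space" and f :: "'a \<Rightarrow> 'b::{banach, second_countable_topology}"
  assumes c: "c \<noteq> 0" and f [measurable]: "f \<in> borel_measurable borel"
  shows "(\<integral>x. f x \<partial>lborel) = \<bar>c\<bar> ^ DIM('a) *\<^sub>R (\<integral>x. f (t + c *\<^sub>R x) \<partial>lborel)"
    and "integrable lborel (\<lambda>x. f (t + c *\<^sub>R x)) \<longleftrightarrow> integrable lborel f"
proof -
  have m: "f \<in> borel_measurable lebesgue"
    using f by (simp add: measurable_completion)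
  show "(\<integral>x. f x \<partial>lborel) = \<bar>c\<bar> ^ DIM('a) *\<^sub>R (\<integral>x. f (t + c *\<^sub>R x) \<partial>lborel)"
    using integral_lebesgue_affine[OF c m, of t] by (simp add: integral_completion)
  show "integrable lborel (\<lambda>x. f (t + c *\<^sub>R x)) \<longleftrightarrow> integrable lborel f"
    using integrable_lebesgue_affine_iff[OF c m, of t] by (simp add: integrable_completion)
qed

lemma nn_integral_lborel_affine:
  fixes t :: "'a::euclidean_space"
  assumes c: "c \<noteq> 0" and f [measurable]: "f \<in> borel_measurable borel"
  shows "(\<integral>\<^sup>+x. f x \<partial>lborel) = ennreal (\<bar>c\<bar> ^ DIM('a)) * (\<integral>\<^sup>+x. f (t + c *\<^sub>R x) \<partial>lborel)"
  using nn_integral_lebesgue_affine[OF c, of f t] f by (simp add: nn_integral_completion measurable_completion)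

lemma integral_lborel_translate:
  fixes t :: "'a::euclidean_space" and f :: "'a \<Rightarrow> 'b::{banach, second_countable_topology}"
  assumes "f \<in> borel_measurable borel"
  shows "(\<integral>x. f (x - t) \<partial>lborel) = (\<integral>x. f x \<partial>lborel)"
    and "integrable lborel (\<lambda>x. f (x - t)) \<longleftrightarrow> integrable lborel f"
  using integral_lborel_affine[of 1 f "- t"] assms by simp_all

lemma integral_lborel_reflect:
  fixes t :: "'a::euclidean_space" and f :: "'a \<Rightarrow> 'b::{banach, second_countable_topology}"
  assumes "f \<in> borel_measurable borel"
  shows "(\<integral>x. f (t - x) \<partial>lborel) = (\<integral>x. f x \<partial>lborel)"
    and "integrable lborel (\<lambda>x. f (t - x)) \<longleftrightarrow> integrable lborel f"
  using integral_lborel_affine[of "-1" f t] assms by simp_all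

lemma nn_integral_lborel_reflect:
  fixes t :: "'a::euclidean_space"
  assumes "f \<in> borel_measurable borel"
  shows "(\<integral>\<^sup>+x. f (t - x) \<partial>lborel) = (\<integral>\<^sup>+x. f x \<partial>lborel)"
    and "(\<integral>\<^sup>+x. f (x - t) \<partial>lborel) = (\<integral>\<^sup>+x. f x \<partial>lborel)"
  using nn_integral_lborel_affine[of "-1" f t] nn_integral_lborel_affine[of 1 f "-t"] assms by simp_all

section \<open>Continuity of translations in L^1\<close>

lemma lborel_inner_compact:
  fixes A :: "'a::euclidean_space set"
  assumes A: "A \<in> sets borel" "emeasure lborel A < \<infinity>" and "0 < e"
  obtains K where "compact K" "K \<subseteq> A" "measure lborel A - e < measure lborel K"
proof -
  have Af: "A \<in> fmeasurable lborel" using A by (auto intro: fmeasurableI)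
  obtain T where T: "closed T" "T \<subseteq> A" "emeasure lebesgue (A - T) < ennreal e"
    using sets_lebesgue_inner_closed[OF _ \<open>0 < e\<close>, of A] A(1) by (metis sets_completionI_sets sets_lborel)
  have TA: "emeasure lborel (A - T) < ennreal e"
    using T A by (simp add: borel_closed)
  have Tf: "T \<in> fmeasurable lborel"
    using fmeasurableI2[OF Af T(2)] T(1) by simp
  have mT: "measure lborel A - e < measure lborel T"
  proof -
    have "measure lborel (A - T) = measure lborel A - measure lborel T"
      using measurable_measure_Diff[OF Af _ T(2)] T(1) by (simp add: borel_closed)
    moreover have "measure lborel (A - T) < e"
      using TA \<open>0 < e\<close> fmeasurableD2[OF fmeasurable.Diff[OF Af Tf]] by (subst (asm) emeasure_eq_ennreal_measure) (auto simp: ennreal_less_iff)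
    ultimately show ?thesis by simp
  qed
  \<comment> \<open>The inner approximation T is only closed. Cutting it with growing balls makes it
    compact, and continuity from below shows that the loss of measure can be kept within the
    remaining margin.\<close>
  have "(\<lambda>n. measure lborel (T \<inter> cball 0 (real n))) \<longlonglongrightarrow> measure lborel (\<Union>n. T \<inter> cball 0 (real n))"
  proof (rule Lim_measure_incseq)
    show "range (\<lambda>n. T \<inter> cball 0 (real n)) \<subseteq> sets lborel" using T(1) by (auto simp: borel_closed)
    show "incseq (\<lambda>n. T \<inter> cball 0 (real n))" by (auto simp: incseq_def)
    show "emeasure lborel (\<Union>n. T \<inter> cball 0 (real n)) \<noteq> \<infinity>"
      using emeasure_mono[of "\<Union>n. T \<inter> cball 0 (real n)" T lborel] fmeasurableD2[OF Tf] T(1)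
      by (auto simp: borel_closed top_unique)
  qed
  also have "(\<Union>n. T \<inter> cball 0 (real n)) = T"
    using real_arch_simple by (auto simp: mem_cball)
  finally have "\<forall>\<^sub>F n in sequentially. measure lborel A - e < measure lborel (T \<inter> cball 0 (real n))"
    using mT order_tendstoD(1) by blast
  then obtain n where "measure lborel A - e < measure lborel (T \<inter> cball 0 (real n))"
    by (auto simp: eventually_sequentially)
  moreover have "compact (T \<inter> cball 0 (real n))"
    using T(1) by (simp add: closed_Int_compact)
  ultimately show ?thesis
    using that[of "T \<inter> cball 0 (real n)"] T(2) by blast
qed

lemma translation_continuous_indicator:
  fixes A :: "'a::euclidean_space set"
  assumes A: "A \<in> sets borel" "emeasure lborel A < \<infinity>" and "0 < e"
  shows "\<exists>d>0. \<forall>z. norm z < d \<longrightarrow> (\<integral>x. \<bar>indicator A (x - z) - indicator A x\<bar> \<partial>lborel) < (e::real)"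
proof -
  have Af: "A \<in> fmeasurable lborel" using A by (auto intro: fmeasurableI)
  obtain K where K: "compact K" "K \<subseteq> A" "measure lborel A - e/4 < measure lborel K"
    using lborel_inner_compact[OF A, of "e/4"] \<open>0 < e\<close> by auto
  obtain U where U: "open U" "A \<subseteq> U" "emeasure lborel (U - A) < ennreal (e/4)"
    using outer_regular_lborel[of A "e/4"] A \<open>0 < e\<close> by auto
  have UAf: "U - A \<in> fmeasurable lborel"
    using U A by (auto intro!: fmeasurableI intro: less_trans[OF _ ennreal_less_top])
  have Uf: "U \<in> fmeasurable lborel"
    using fmeasurable.Un[OF UAf Af] U(2) by (simp add: Un_absorb2)
  have Kf: "K \<in> fmeasurable lborel"
    using fmeasurableI2[OF Af K(2)] K(1) by (simp add: compact_imp_closed)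
  have mU: "measure lborel U < measure lborel A + e/4"
  proof -
    have "measure lborel (U - A) = measure lborel U - measure lborel A"
      using measurable_measure_Diff[OF Uf _ U(2)] A by simp
    moreover have "measure lborel (U - A) < e/4"
      using U(3) \<open>0 < e\<close> fmeasurableD2[OF UAf]
      by (subst (asm) emeasure_eq_ennreal_measure) (auto simp: ennreal_less_iff)
    ultimately show ?thesis by simp
  qed
  have "K \<inter> - U = {}" using K(2) U(2) by auto
  then obtain d where d: "0 < d" "\<And>x y. x \<in> K \<Longrightarrow> y \<in> - U \<Longrightarrow> d \<le> dist x y"
    using separate_compact_closed[of K "- U"] K(1) U(1) by (auto simp: closed_Compl)
  have [measurable]: "A \<in> sets borel" "U \<in> sets borel" "K \<in> sets borel"
    using A U K by (auto simp: compact_imp_closed)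
  have iA: "integrable lborel (indicator A :: _ \<Rightarrow> real)" "integrable lborel (indicator U :: _ \<Rightarrow> real)"
    "integrable lborel (indicator K :: _ \<Rightarrow> real)"
    using Af Uf Kf by (auto simp: integrable_indicator_iff fmeasurable_def)
  show ?thesis
  proof (intro exI[of _ d] conjI allI impI d)
    fix z :: 'a assume z: "norm z < d"
    have s1: "x \<in> U" if "x - z \<in> K" for x
      using d(2)[OF that, of x] z by (force simp: dist_norm)
    have s2: "x - z \<in> U" if "x \<in> K" for x
      using d(2)[OF that, of "x - z"] z by (force simp: dist_norm)
    have int: "integrable lborel (\<lambda>x. f (x - z))" if "integrable lborel f" for f :: "'a \<Rightarrow> real"
      using integral_lborel_translate(2)[of f z] that by (auto dest: borel_measurable_integrable)
    \<comment> \<open>With K inside A inside U and z shorter than the distance from K to the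
      complement of U, shifting K by z in either direction stays in U. Both brackets are therefore
      nonnegative, and whenever the indicators of A differ, one of them equals 1. By translation
      invariance the integral is twice the measure gap between U and K.\<close>
    have "(\<integral>x. \<bar>indicator A (x - z) - indicator A x\<bar> \<partial>lborel) \<le>
        (\<integral>x. (indicator U x - indicator K (x - z)) + (indicator U (x - z) - indicator K x) \<partial>lborel :: real)"
    proof (rule integral_mono)
      show "integrable lborel (\<lambda>x. \<bar>indicator A (x - z) - indicator A x\<bar> :: real)"
        using iA int[OF iA(1)] by auto
      show "integrable lborel (\<lambda>x. (indicator U x - indicator K (x - z)) + (indicator U (x - z) - indicator K x) :: real)"
        using iA int[OF iA(2)] int[OF iA(3)] by auto
      show "\<bar>indicator A (x - z) - indicator A x\<bar> \<le>
        ((indicator U x - indicator K (x - z)) + (indicator U (x - z) - indicator K x) :: real)" for x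
        using s1 s2 K(2) U(2) by (auto simp: indicator_def)
    qed
    also have "\<dots> = 2 * (measure lborel U - measure lborel K)"
      using iA int[OF iA(2)] int[OF iA(3)]
        integral_lborel_translate(1)[of "indicator U :: _ \<Rightarrow> real" z]
        integral_lborel_translate(1)[of "indicator K :: _ \<Rightarrow> real" z]
      by simp
    also have "\<dots> < e"
      using K(3) mU by simp
    finally show "(\<integral>x. \<bar>indicator A (x - z) - indicator A x\<bar> \<partial>lborel) < e" .
  qed
qed

lemma translation_continuous_L1:
  fixes f :: "'a::euclidean_space \<Rightarrow> 'b::{banach, second_countable_topology}"
  assumes "integrable lborel f"
  shows "\<And>e::real. 0 < e \<Longrightarrow>
    \<exists>d>0. \<forall>z. norm z < d \<longrightarrow> (\<integral>x. norm (f (x - z) - f x) \<partial>lborel) < e"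
  using assms
proof (induction f rule: integrable_induct)
  case (base A c)
  \<comment> \<open>The summand 1 covers the case \<open>c = 0\<close>.\<close>
  have "0 < e / (norm c + 1)" using base by (simp add: add_nonneg_pos)
  then obtain d where d: "d > 0" "\<And>z. norm z < d \<Longrightarrow>
      (\<integral>x. \<bar>indicator A (x - z) - indicator A x\<bar> \<partial>lborel) < e / (norm c + 1)"
    using translation_continuous_indicator[of A "e / (norm c + 1)"] base by auto
  show ?case
  proof (intro exI[of _ d] conjI allI impI d)
    fix z :: 'a assume "norm z < d"
    have "(\<integral>x. norm (indicator A (x - z) *\<^sub>R c - indicator A x *\<^sub>R c) \<partial>lborel)
        = (\<integral>x. \<bar>indicator A (x - z) - indicator A x\<bar> \<partial>lborel) * norm c"
      by (simp flip: scaleR_left_diff_distrib)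
    also have "\<dots> \<le> (\<integral>x. \<bar>indicator A (x - z) - indicator A x\<bar> \<partial>lborel) * (norm c + 1)"
      by (intro mult_left_mono) (auto intro!: integral_nonneg)
    also have "\<dots> < e"
      using d(2)[OF \<open>norm z < d\<close>] by (simp add: pos_less_divide_eq add_nonneg_pos)
    finally show "(\<integral>x. norm (indicator A (x - z) *\<^sub>R c - indicator A x *\<^sub>R c) \<partial>lborel) < e" .
  qed
next
  case (add f g)
  obtain d1 where d1: "d1 > 0" "\<And>z. norm z < d1 \<Longrightarrow> (\<integral>x. norm (f (x - z) - f x) \<partial>lborel) < e/2"
    using add(3)[of "e/2"] add.prems by auto
  obtain d2 where d2: "d2 > 0" "\<And>z. norm z < d2 \<Longrightarrow> (\<integral>x. norm (g (x - z) - g x) \<partial>lborel) < e/2"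
    using add(4)[of "e/2"] add.prems by auto
  show ?case
  proof (intro exI[of _ "min d1 d2"] conjI allI impI)
    fix z :: 'a assume z: "norm z < min d1 d2"
    have [measurable]: "f \<in> borel_measurable borel" "g \<in> borel_measurable borel"
      using add by auto
    have int: "integrable lborel (\<lambda>x. f (x - z))" "integrable lborel (\<lambda>x. g (x - z))"
      using add by (auto simp: integral_lborel_translate(2))
    have "(\<integral>x. norm (f (x - z) + g (x - z) - (f x + g x)) \<partial>lborel)
       \<le> (\<integral>x. norm (f (x - z) - f x) + norm (g (x - z) - g x) \<partial>lborel)"
      using int add by (intro integral_mono) (auto intro: norm_diff_triangle_ineq)
    also have "\<dots> < e/2 + e/2"
      using int add d1(2)[of z] d2(2)[of z] z
      by (subst Bochner_Integration.integral_add) (auto simp: field_simps)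
    finally show "(\<integral>x. norm (f (x - z) + g (x - z) - (f x + g x)) \<partial>lborel) < e" by simp
  qed (use d1 d2 in auto)
next
  case (lim f s)
  have [measurable]: "f \<in> borel_measurable borel" "\<And>i. s i \<in> borel_measurable borel"
    using lim by (auto dest: borel_measurable_integrable)
  \<comment> \<open>The approximants satisfy \<open>norm (s i x) \<le> 2 * norm (f x)\<close>,
    whence the dominating function with factor 3.\<close>
  have "(\<lambda>i. \<integral>x. norm (s i x - f x) \<partial>lborel) \<longlonglongrightarrow> (\<integral>x. 0 \<partial>(lborel :: 'a measure))"
  proof (rule integral_dominated_convergence[where w="\<lambda>x. 3 * norm (f x)"])
    show "AE x in lborel. (\<lambda>i. norm (s i x - f x)) \<longlonglongrightarrow> 0"
      using lim(2) by (auto simp: tendsto_norm_zero_iff LIM_zero_iff)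
    show "AE x in lborel. norm (norm (s i x - f x)) \<le> 3 * norm (f x)" for i
    proof (rule AE_I2)
      fix x show "norm (norm (s i x - f x)) \<le> 3 * norm (f x)"
        using lim(3)[of x i] norm_triangle_ineq4[of "s i x" "f x"] by simp
    qed
  qed (use lim in auto)
  then have "\<forall>\<^sub>F i in sequentially. (\<integral>x. norm (s i x - f x) \<partial>lborel) < e/3"
    using lim.prems by (intro order_tendstoD(2)) auto
  then obtain i where i: "(\<integral>x. norm (s i x - f x) \<partial>lborel) < e/3"
    by (auto simp: eventually_sequentially)
  obtain d where d: "d > 0" "\<And>z. norm z < d \<Longrightarrow> (\<integral>x. norm (s i (x - z) - s i x) \<partial>lborel) < e/3"
    using lim(5)[of "e/3" i] lim.prems by auto
  show ?case
  proof (intro exI[of _ d] conjI allI impI d)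
    fix z :: 'a assume z: "norm z < d"
    have i0: "integrable lborel (\<lambda>x. norm (s i x - f x))"
      using lim by auto
    have int: "integrable lborel (\<lambda>x. f (x - z))" "integrable lborel (\<lambda>x. s i (x - z))"
      "integrable lborel (\<lambda>x. norm (s i (x - z) - f (x - z)))"
      using lim i0 by (auto simp: integral_lborel_translate(2))
    have "(\<integral>x. norm (f (x - z) - f x) \<partial>lborel)
      \<le> (\<integral>x. norm (s i (x - z) - f (x - z)) + norm (s i (x - z) - s i x) + norm (s i x - f x) \<partial>lborel)"
    proof (rule integral_mono)
      fix x
      have "f (x - z) - f x = - (s i (x - z) - f (x - z)) + (s i (x - z) - s i x) + (s i x - f x)"
        by simp
      then show "norm (f (x - z) - f x) \<le> norm (s i (x - z) - f (x - z)) + norm (s i (x - z) - s i x) + norm (s i x - f x)"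
        by (simp only:) (intro norm_triangle_mono norm_triangle_ineq order_refl, simp only: norm_minus_cancel order_refl)
    qed (use int lim i0 in auto)
    also have "\<dots> = (\<integral>x. norm (s i (x - z) - f (x - z)) \<partial>lborel) + (\<integral>x. norm (s i (x - z) - s i x) \<partial>lborel)
        + (\<integral>x. norm (s i x - f x) \<partial>lborel)"
      using int lim i0 by simp
    also have "(\<integral>x. norm (s i (x - z) - f (x - z)) \<partial>lborel) = (\<integral>x. norm (s i x - f x) \<partial>lborel)"
      by (rule integral_lborel_translate(1)[of "\<lambda>x. norm (s i x - f x)"]) simp
    finally show "(\<integral>x. norm (f (x - z) - f x) \<partial>lborel) < e"
      using i d(2)[OF z] by simp
  qed
qed

section \<open>Mollification\<close>

text \<open>This collects what the averaging estimates use. Smoothness enters separately, where a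
  kernel serves as a test function in \<open>test_fun_mollifier_seq\<close>.\<close>

definition mollifier :: "real \<Rightarrow> ('a::euclidean_space \<Rightarrow> real) \<Rightarrow> bool" where
  "mollifier r k \<longleftrightarrow> continuous_on UNIV k \<and> (\<forall>x. 0 \<le> k x) \<and> (\<forall>x. r < norm x \<longrightarrow> k x = 0) \<and>
     (\<integral>x. k x \<partial>lborel) = 1"

definition convolve :: "('a::euclidean_space \<Rightarrow> real) \<Rightarrow> ('a \<Rightarrow> 'b::euclidean_space) \<Rightarrow> 'a \<Rightarrow> 'b" where
  "convolve k f x = (\<integral>y. k (x - y) *\<^sub>R f y \<partial>lborel)"

lemma compact_support_bounded:
  fixes k :: "'a::euclidean_space \<Rightarrow> real"
  assumes "continuous_on UNIV k" "\<And>x. r < norm x \<Longrightarrow> k x = 0"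
  obtains M where "0 < M" "\<And>x. \<bar>k x\<bar> \<le> M"
proof -
  have "bounded (k ` cball 0 r)"
    by (intro compact_imp_bounded compact_continuous_image) (auto intro: continuous_on_subset assms)
  then obtain M where M: "0 < M" "\<And>x. x \<in> cball 0 r \<Longrightarrow> \<bar>k x\<bar> \<le> M"
    by (auto simp: bounded_pos)
  have "\<bar>k x\<bar> \<le> M" for x
    using M assms(2)[of x] by (cases "norm x \<le> r") auto
  with M show ?thesis using that by blast
qed

lemma compact_support_integrable:
  fixes k :: "'a::euclidean_space \<Rightarrow> real"
  assumes "continuous_on UNIV k" "\<And>x. r < norm x \<Longrightarrow> k x = 0"
  shows "integrable lborel k"
proof -
  have "integrable lborel (\<lambda>x. indicator (cball 0 r) x *\<^sub>R k x)"
    by (rule borel_integrable_compact) (auto intro: continuous_on_subset assms)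
  also have "(\<lambda>x. indicator (cball 0 r) x *\<^sub>R k x) = k"
    using assms(2) by (force simp: indicator_def)
  finally show ?thesis .
qed

context
  fixes r :: real and k :: "'a::euclidean_space \<Rightarrow> real"
  assumes k: "mollifier r k"
begin

lemma mollifier_borel [measurable]: "k \<in> borel_measurable borel"
  using k by (auto simp: mollifier_def intro: borel_measurable_continuous_onI)

lemma mollifier_nonneg: "0 \<le> k x"
  using k by (simp add: mollifier_def)

lemma mollifier_integrable: "integrable lborel k"
  using k by (intro compact_support_integrable[of k r]) (auto simp: mollifier_def)

lemma mollifier_shift:
  "integrable lborel (\<lambda>y. k (x - y))" "(\<integral>y. k (x - y) \<partial>lborel) = 1"
  using integral_lborel_reflect[OF mollifier_borel, of x] mollifier_integrable k
  by (auto simp: mollifier_def)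

lemma mollifier_nn_integral: "(\<integral>\<^sup>+x. k x \<partial>lborel) = 1"
  using k nn_integral_eq_integral[OF mollifier_integrable] mollifier_nonneg
  by (auto simp: mollifier_def)

lemma integrable_mollifier_mult:
  fixes f :: "'a \<Rightarrow> 'b::euclidean_space"
  assumes f: "integrable lborel f"
  shows "integrable lborel (\<lambda>y. k (x - y) *\<^sub>R f y)"
proof -
  obtain M where M: "0 < M" "\<And>x. \<bar>k x\<bar> \<le> M"
    using compact_support_bounded[of k r] k by (auto simp: mollifier_def)
  show ?thesis
  proof (rule Bochner_Integration.integrable_bound)
    show "integrable lborel (\<lambda>y. M * norm (f y))" using f by auto
    have [measurable]: "f \<in> borel_measurable borel" using f by auto
    show "(\<lambda>y. k (x - y) *\<^sub>R f y) \<in> borel_measurable lborel" by simp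
    show "AE y in lborel. norm (k (x - y) *\<^sub>R f y) \<le> norm (M * norm (f y))"
      using M by (auto simp: abs_mult intro!: mult_right_mono)
  qed
qed

lemma borel_measurable_convolve:
  fixes f :: "'a \<Rightarrow> 'b::euclidean_space"
  assumes [measurable]: "f \<in> borel_measurable borel"
  shows "convolve k f \<in> borel_measurable borel"
  unfolding convolve_def[abs_def] by measurable

text \<open>As k has mass 1, \<open>convolve k f x - f x\<close> is the k-average over z of
  \<open>f (x - z) - f x\<close>. Tonelli moves the x-integral inside, and only shifts with
  \<open>norm z \<le> r\<close> carry weight.\<close>

lemma convolve_L1_approx:
  fixes f :: "'a \<Rightarrow> 'b::euclidean_space"
  assumes f: "integrable lborel f"
    and e: "\<And>z. norm z \<le> r \<Longrightarrow> (\<integral>x. norm (f (x - z) - f x) \<partial>lborel) \<le> e"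
  shows "(\<integral>\<^sup>+x. norm (convolve k f x - f x) \<partial>lborel) \<le> ennreal e"
proof -
  have [measurable]: "f \<in> borel_measurable borel" using f by auto
  have z1: "convolve k f x = (\<integral>z. k z *\<^sub>R f (x - z) \<partial>lborel)"
    and z2: "integrable lborel (\<lambda>z. k z *\<^sub>R f (x - z))" for x
    using integral_lborel_reflect[of "\<lambda>y. k (x - y) *\<^sub>R f y" x] integrable_mollifier_mult[OF f, of x]
    by (auto simp: convolve_def)
  have "ennreal (norm (convolve k f x - f x)) \<le> (\<integral>\<^sup>+z. k z * norm (f (x - z) - f x) \<partial>lborel)" for x
  proof -
    have "(\<integral>z. k z *\<^sub>R f x \<partial>lborel) = f x"
      using mollifier_integrable k by (simp add: mollifier_def)
    then have "convolve k f x - f x = (\<integral>z. k z *\<^sub>R (f (x - z) - f x) \<partial>lborel)"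
      using z1[of x] z2[of x] mollifier_integrable by (simp add: scaleR_right_diff_distrib)
    also have "ennreal (norm \<dots>) \<le> (\<integral>\<^sup>+z. norm (k z *\<^sub>R (f (x - z) - f x)) \<partial>lborel)"
      using z2[of x] mollifier_integrable
      by (intro integral_norm_bound_ennreal) (auto simp: scaleR_right_diff_distrib)
    finally show ?thesis by (simp add: mollifier_nonneg)
  qed
  then have "(\<integral>\<^sup>+x. norm (convolve k f x - f x) \<partial>lborel)
      \<le> (\<integral>\<^sup>+x. \<integral>\<^sup>+z. k z * norm (f (x - z) - f x) \<partial>lborel \<partial>lborel)"
    by (intro nn_integral_mono)
  also have "\<dots> = (\<integral>\<^sup>+z. \<integral>\<^sup>+x. k z * norm (f (x - z) - f x) \<partial>lborel \<partial>lborel)"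
    by (rule lborel_pair.Fubini'[symmetric]) measurable
  also have "\<dots> \<le> (\<integral>\<^sup>+z. k z * ennreal e \<partial>lborel)"
  proof (rule nn_integral_mono)
    fix z
    have "(\<integral>\<^sup>+x. k z * norm (f (x - z) - f x) \<partial>lborel) = k z * (\<integral>\<^sup>+x. norm (f (x - z) - f x) \<partial>lborel)"
      by (simp add: nn_integral_cmult ennreal_mult mollifier_nonneg)
    also have "\<dots> \<le> k z * ennreal e"
    proof (cases "norm z \<le> r")
      case True
      have "integrable lborel (\<lambda>x. f (x - z) - f x)"
        using f integral_lborel_translate(2)[of f z] by auto
      then have "(\<integral>\<^sup>+x. norm (f (x - z) - f x) \<partial>lborel) = ennreal (\<integral>x. norm (f (x - z) - f x) \<partial>lborel)"
        by (intro nn_integral_eq_integral) auto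
      with e[OF True] show ?thesis by (auto intro!: mult_left_mono ennreal_leI)
    next
      case False
      with k show ?thesis by (simp add: mollifier_def)
    qed
    finally show "(\<integral>\<^sup>+x. k z * norm (f (x - z) - f x) \<partial>lborel) \<le> k z * ennreal e" .
  qed
  also have "\<dots> = ennreal e"
    by (simp add: nn_integral_multc mollifier_nn_integral)
  finally show ?thesis .
qed

lemma integrable_convolve_square:
  fixes f :: "'a \<Rightarrow> 'b::euclidean_space"
  assumes [measurable]: "f \<in> borel_measurable borel" and f: "integrable lborel (\<lambda>x. (norm (f x))\<^sup>2)"
  shows "integrable lborel (\<lambda>y. k (x - y) * (norm (f y))\<^sup>2)"
    and "integrable lborel (\<lambda>y. k (x - y) *\<^sub>R f y)"
proof -
  show *: "integrable lborel (\<lambda>y. k (x - y) * (norm (f y))\<^sup>2)"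
    using integrable_mollifier_mult[OF f] by simp
  show "integrable lborel (\<lambda>y. k (x - y) *\<^sub>R f y)"
  proof (rule Bochner_Integration.integrable_bound)
    show "integrable lborel (\<lambda>y. k (x - y) + k (x - y) * (norm (f y))\<^sup>2)"
      using * mollifier_shift(1) by auto
    have "norm (f y) \<le> 1 + (norm (f y))\<^sup>2" for y
      using sum_squares_bound[of 1 "norm (f y)"] norm_ge_zero[of "f y"]
      unfolding power2_eq_square by linarith
    then have "k (x - y) * norm (f y) \<le> k (x - y) * (1 + (norm (f y))\<^sup>2)" for y
      by (intro mult_left_mono mollifier_nonneg)
    then show "AE y in lborel. norm (k (x - y) *\<^sub>R f y) \<le> norm (k (x - y) + k (x - y) * (norm (f y))\<^sup>2)"
      by (auto simp: mollifier_nonneg algebra_simps)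
  qed simp
qed

text \<open>Jensen's inequality, obtained by integrating \<open>2ct \<le> c\<^sup>2 + t\<^sup>2\<close> with \<open>c\<close> the mean of \<open>t\<close>.\<close>

lemma norm_convolve_square_le:
  fixes f :: "'a \<Rightarrow> 'b::euclidean_space"
  assumes [measurable]: "f \<in> borel_measurable borel" and f: "integrable lborel (\<lambda>x. (norm (f x))\<^sup>2)"
  shows "(norm (convolve k f x))\<^sup>2 \<le> (\<integral>y. k (x - y) * (norm (f y))\<^sup>2 \<partial>lborel)"
proof -
  define c where "c = (\<integral>y. k (x - y) * norm (f y) \<partial>lborel)"
  note i = integrable_convolve_square[OF assms, of x]
  have i': "integrable lborel (\<lambda>y. k (x - y) * norm (f y))"
    using integrable_norm[OF i(2)] by (simp add: mollifier_nonneg)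
  have c: "norm (convolve k f x) \<le> c"
    unfolding convolve_def c_def using integral_norm_bound[of lborel "\<lambda>y. k (x - y) *\<^sub>R f y"]
    by (simp add: mollifier_nonneg)
  have "2 * c * c = (\<integral>y. (2 * c) * (k (x - y) * norm (f y)) \<partial>lborel)"
    by (subst integral_mult_right_zero) (simp flip: c_def)
  also have "\<dots> = (\<integral>y. k (x - y) * (2 * c * norm (f y)) \<partial>lborel)"
    by (rule Bochner_Integration.integral_cong) auto
  also have "\<dots> \<le> (\<integral>y. k (x - y) * (c\<^sup>2 + (norm (f y))\<^sup>2) \<partial>lborel)"
  proof (intro integral_mono mult_left_mono mollifier_nonneg)
    show "integrable lborel (\<lambda>y. k (x - y) * (2 * c * norm (f y)))"
      using integrable_mult_right[OF i', of "2 * c"] by (simp add: ac_simps)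
    show "integrable lborel (\<lambda>y. k (x - y) * (c\<^sup>2 + (norm (f y))\<^sup>2))"
      using i mollifier_shift(1) by (auto simp: distrib_left)
  qed (simp add: sum_squares_bound)
  also have "\<dots> = c\<^sup>2 + (\<integral>y. k (x - y) * (norm (f y))\<^sup>2 \<partial>lborel)"
    using i mollifier_shift by (simp add: distrib_left)
  finally have "c\<^sup>2 \<le> (\<integral>y. k (x - y) * (norm (f y))\<^sup>2 \<partial>lborel)"
    by (simp add: power2_eq_square)
  with c show ?thesis
    by (meson norm_ge_zero order_trans power_mono)
qed

text \<open>Young's inequality for a kernel of mass 1: integrate the pointwise Jensen bound in x and
  exchange the integrals. That the norm does not grow, rather than merely staying finite, is what
  later keeps the gradient integrals uniformly bounded.\<close>

lemma convolve_square_integrable: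
  fixes f :: "'a \<Rightarrow> 'b::euclidean_space"
  assumes [measurable]: "f \<in> borel_measurable borel" and f: "integrable lborel (\<lambda>x. (norm (f x))\<^sup>2)"
  shows "integrable lborel (\<lambda>x. (norm (convolve k f x))\<^sup>2)"
    and "(\<integral>x. (norm (convolve k f x))\<^sup>2 \<partial>lborel) \<le> (\<integral>x. (norm (f x))\<^sup>2 \<partial>lborel)"
proof -
  note [measurable] = borel_measurable_convolve[OF assms(1)]
  have "(\<integral>\<^sup>+x. (norm (convolve k f x))\<^sup>2 \<partial>lborel)
      \<le> (\<integral>\<^sup>+x. \<integral>\<^sup>+y. ennreal (k (x - y)) * ennreal ((norm (f y))\<^sup>2) \<partial>lborel \<partial>lborel)"
  proof (rule nn_integral_mono)
    fix x
    have "(\<integral>\<^sup>+y. ennreal (k (x - y)) * ennreal ((norm (f y))\<^sup>2) \<partial>lborel)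
      = ennreal (\<integral>y. k (x - y) * (norm (f y))\<^sup>2 \<partial>lborel)"
      by (subst nn_integral_eq_integral[symmetric])
         (auto simp: integrable_convolve_square[OF assms] mollifier_nonneg ennreal_mult)
    then show "ennreal ((norm (convolve k f x))\<^sup>2)
       \<le> (\<integral>\<^sup>+y. ennreal (k (x - y)) * ennreal ((norm (f y))\<^sup>2) \<partial>lborel)"
      using norm_convolve_square_le[OF assms, of x] by (simp add: ennreal_leI)
  qed
  also have "\<dots> = (\<integral>\<^sup>+y. \<integral>\<^sup>+x. ennreal (k (x - y)) * ennreal ((norm (f y))\<^sup>2) \<partial>lborel \<partial>lborel)"
    by (rule lborel_pair.Fubini'[symmetric]) measurable
  also have "\<dots> = (\<integral>\<^sup>+y. (norm (f y))\<^sup>2 \<partial>lborel)"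
    using nn_integral_lborel_reflect(2)[of "\<lambda>x. ennreal (k x)"] mollifier_nn_integral
    by (simp add: nn_integral_multc)
  also have "\<dots> = ennreal (\<integral>x. (norm (f x))\<^sup>2 \<partial>lborel)"
    using f by (intro nn_integral_eq_integral) auto
  finally have *: "(\<integral>\<^sup>+x. (norm (convolve k f x))\<^sup>2 \<partial>lborel) \<le> ennreal (\<integral>x. (norm (f x))\<^sup>2 \<partial>lborel)" .
  then show i: "integrable lborel (\<lambda>x. (norm (convolve k f x))\<^sup>2)"
    by (intro integrableI_bounded) (auto intro: le_less_trans)
  show "(\<integral>x. (norm (convolve k f x))\<^sup>2 \<partial>lborel) \<le> (\<integral>x. (norm (f x))\<^sup>2 \<partial>lborel)"
    using * nn_integral_eq_integral[OF i] by (simp add: ennreal_le_iff)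
qed

text \<open>Square integrability together with this bound puts a mollified function into L^4,
  without any embedding theorem.\<close>

lemma convolve_bounded:
  fixes f :: "'a \<Rightarrow> 'b::euclidean_space"
  assumes [measurable]: "f \<in> borel_measurable borel" and f: "integrable lborel (\<lambda>x. (norm (f x))\<^sup>2)"
  obtains B where "\<And>x. (norm (convolve k f x))\<^sup>2 \<le> B"
proof -
  obtain M where M: "0 < M" "\<And>x. \<bar>k x\<bar> \<le> M"
    using compact_support_bounded[of k r] k by (auto simp: mollifier_def)
  have "(norm (convolve k f x))\<^sup>2 \<le> (\<integral>y. M * (norm (f y))\<^sup>2 \<partial>lborel)" for x
  proof (rule order_trans[OF norm_convolve_square_le[OF assms]], rule integral_mono)
    show "k (x - y) * (norm (f y))\<^sup>2 \<le> M * (norm (f y))\<^sup>2" for y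
      using M(2)[of "x - y"] by (intro mult_right_mono) auto
  qed (use f integrable_convolve_square[OF assms] in auto)
  then show ?thesis using that by blast
qed

text \<open>The support of the kernel centred at \<open>X n\<close> leaves every fixed point, so
  dominated convergence applies to the Jensen bound. Combined with invariance along an axis, this
  decay will force a convolution to vanish.\<close>

lemma convolve_decay:
  fixes f :: "'a \<Rightarrow> 'b::euclidean_space"
  assumes [measurable]: "f \<in> borel_measurable borel" and f: "integrable lborel (\<lambda>x. (norm (f x))\<^sup>2)"
    and X: "filterlim (\<lambda>n. norm (X n)) at_top sequentially"
  shows "(\<lambda>n::nat. convolve k f (X n)) \<longlonglongrightarrow> 0"
proof -
  obtain M where M: "0 < M" "\<And>x. \<bar>k x\<bar> \<le> M"
    using compact_support_bounded[of k r] k by (auto simp: mollifier_def)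
  have "(\<lambda>n. \<integral>y. k (X n - y) * (norm (f y))\<^sup>2 \<partial>lborel) \<longlonglongrightarrow> (\<integral>y. 0 \<partial>(lborel :: 'a measure))"
  proof (rule integral_dominated_convergence[where w="\<lambda>y. M * (norm (f y))\<^sup>2"])
    show "AE y in lborel. norm (k (X n - y) * (norm (f y))\<^sup>2) \<le> M * (norm (f y))\<^sup>2" for n
      using M(2) by (auto simp: abs_mult intro!: mult_right_mono)
    show "AE y in lborel. (\<lambda>n. k (X n - y) * (norm (f y))\<^sup>2) \<longlonglongrightarrow> 0"
    proof (rule AE_I2, rule tendsto_eventually)
      fix y :: 'a
      have "\<forall>\<^sub>F n in sequentially. r + norm y < norm (X n)"
        using X by (simp add: filterlim_at_top_dense)
      then show "\<forall>\<^sub>F n in sequentially. k (X n - y) * (norm (f y))\<^sup>2 = 0"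
      proof eventually_elim
        case (elim n)
        then have "r < norm (X n - y)"
          using norm_triangle_ineq2[of "X n" y] by linarith
        then show ?case using k by (simp add: mollifier_def)
      qed
    qed
  qed (use f in auto)
  then have lim: "(\<lambda>n. \<integral>y. k (X n - y) * (norm (f y))\<^sup>2 \<partial>lborel) \<longlonglongrightarrow> 0"
    by simp
  have "(\<lambda>n. (norm (convolve k f (X n)))\<^sup>2) \<longlonglongrightarrow> 0"
  proof (rule tendsto_sandwich[OF _ _ tendsto_const lim])
    show "\<forall>\<^sub>F n in sequentially. 0 \<le> (norm (convolve k f (X n)))\<^sup>2"
      by simp
    show "\<forall>\<^sub>F n in sequentially. (norm (convolve k f (X n)))\<^sup>2
        \<le> (\<integral>y. k (X n - y) * (norm (f y))\<^sup>2 \<partial>lborel)"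
      by (intro always_eventually allI norm_convolve_square_le[OF assms(1,2)])
  qed
  then have "(\<lambda>n. sqrt ((norm (convolve k f (X n)))\<^sup>2)) \<longlonglongrightarrow> sqrt 0"
    by (rule tendsto_real_sqrt)
  then show ?thesis by (simp add: tendsto_norm_zero_iff)
qed

end

lemma convolve_AE_subseq:
  fixes f :: "'a::euclidean_space \<Rightarrow> 'b::euclidean_space"
  assumes f: "integrable lborel f" and k: "\<And>n. mollifier (r n) (k n)" and r: "r \<longlonglongrightarrow> 0"
  shows "\<exists>s. strict_mono s \<and> (AE x in lborel. (\<lambda>n. convolve (k (s n)) f x) \<longlonglongrightarrow> f x)"
proof -
  have [measurable]: "f \<in> borel_measurable borel" using f by auto
  have [measurable]: "convolve (k n) f \<in> borel_measurable borel" for n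
    by (rule borel_measurable_convolve[OF k]) simp
  have lim: "(\<lambda>n. \<integral>\<^sup>+x. norm (convolve (k n) f x - f x) \<partial>lborel) \<longlonglongrightarrow> 0"
  proof (rule tendsto_zero_ennreal)
    fix e :: real assume "0 < e"
    then obtain d where d: "d > 0" "\<And>z. norm z < d \<Longrightarrow> (\<integral>x. norm (f (x - z) - f x) \<partial>lborel) < e/2"
      using translation_continuous_L1[OF f, of "e/2"] by auto
    have "\<forall>\<^sub>F n in sequentially. r n < d"
      using r d(1) by (rule order_tendstoD)
    then show "\<forall>\<^sub>F n in sequentially. (\<integral>\<^sup>+x. norm (convolve (k n) f x - f x) \<partial>lborel) < ennreal e"
    proof eventually_elim
      case (elim n)
      have "(\<integral>\<^sup>+x. norm (convolve (k n) f x - f x) \<partial>lborel) \<le> ennreal (e/2)"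
        using elim d(2) by (intro convolve_L1_approx[OF k f]) (auto intro: less_imp_le)
      also have "\<dots> < ennreal e" using \<open>0 < e\<close> by (simp add: ennreal_less_iff)
      finally show ?case .
    qed
  qed
  \<comment> \<open>Integrability of the difference is read off from finiteness of the nonnegative
    integral, which the limit gives only for large n. Hence the shift by N before an almost
    everywhere convergent subsequence is extracted.\<close>
  have int: "\<forall>\<^sub>F n in sequentially. integrable lborel (\<lambda>x. convolve (k n) f x - f x)"
    using order_tendstoD(2)[OF lim ennreal_zero_less_top]
    by (rule eventually_mono) (simp add: integrable_iff_bounded)
  then obtain N where N: "\<And>n. N \<le> n \<Longrightarrow> integrable lborel (\<lambda>x. convolve (k n) f x - f x)"
    by (auto simp: eventually_sequentially)
  have "(\<lambda>n. \<integral>\<^sup>+x. norm (convolve (k (n + N)) f x - f x) \<partial>lborel) \<longlonglongrightarrow> ennreal 0"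
    using LIMSEQ_ignore_initial_segment[OF lim, of N] by simp
  also have "(\<lambda>n. \<integral>\<^sup>+x. norm (convolve (k (n + N)) f x - f x) \<partial>lborel)
      = (\<lambda>n. ennreal (\<integral>x. norm (convolve (k (n + N)) f x - f x) \<partial>lborel))"
    using N by (intro ext nn_integral_eq_integral) auto
  finally have "(\<lambda>n. \<integral>x. norm (convolve (k (n + N)) f x - f x) \<partial>lborel) \<longlonglongrightarrow> 0"
    by (subst (asm) tendsto_ennreal_iff) auto
  then obtain s where s: "strict_mono s"
      "AE x in lborel. (\<lambda>n. convolve (k (s n + N)) f x - f x) \<longlonglongrightarrow> 0"
    using tendsto_L1_AE_subseq[of lborel "\<lambda>n x. convolve (k (n + N)) f x - f x"] N by auto
  then show ?thesis
    by (intro exI[of _ "\<lambda>n. s n + N"]) (auto simp: strict_mono_def LIM_zero_iff)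
qed

section \<open>Test functions\<close>

text \<open>The factor \<open>CARD('n)\<close> compensates the loss in
  \<open>coord_prod_eq_0_norm\<close>, so that the support lies in the ball of radius
  \<open>1 / Suc n\<close>.\<close>

definition bump_prod :: "nat \<Rightarrow> real^'n::finite \<Rightarrow> real" where
  "bump_prod n = coord_prod (\<lambda>_ t. bump (real (CARD('n) * Suc n) * t))"

definition mollifier_seq :: "nat \<Rightarrow> real^'n::finite \<Rightarrow> real" where
  "mollifier_seq n x = bump_prod n x / (\<integral>y. bump_prod n (y :: real^'n) \<partial>lborel)"

lemma coord_prod_cmult:
  "coord_prod (\<lambda>j t. (if j = i then c else 1) * h j t) = (\<lambda>x. c * coord_prod h x)"
  by (auto simp: coord_prod_def prod.distrib)

lemma test_fun_supportE:
  assumes "test_fun \<psi>"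
  obtains R where "\<And>x. R < norm x \<Longrightarrow> \<psi> x = 0" "\<And>x i. R < norm x \<Longrightarrow> partial_deriv i \<psi> x = 0"
proof -
  obtain R where R: "\<And>x. x \<in> closure {x. \<psi> x \<noteq> 0} \<Longrightarrow> norm x \<le> R"
    using assms unfolding test_fun_def by (meson bounded_iff compact_imp_bounded)
  have 0: "\<psi> x = 0" if "R < norm x" for x
    using R[of x] closure_subset[of "{x. \<psi> x \<noteq> 0}"] that by fastforce
  have "partial_deriv i \<psi> x = 0" if "R < norm x" for x i
  proof -
    have "open {x. R < norm x}" by (intro open_Collect_less continuous_intros)
    then have "(\<psi> has_derivative (\<lambda>_. 0)) (at x)"
      by (rule has_derivative_transform_within_open[OF has_derivative_const[of 0]]) (use that 0 in auto)
    from frechet_derivative_at[OF this, symmetric] show ?thesis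
      by (simp add: partial_deriv_def)
  qed
  with 0 show ?thesis using that by blast
qed

lemma test_fun_continuous:
  assumes "test_fun \<psi>"
  shows "continuous_on UNIV \<psi>" "continuous_on UNIV (partial_deriv i \<psi>)"
proof -
  have *: "foldr partial_deriv is \<psi> differentiable (at x)" for "is" x
    using assms by (simp add: test_fun_def smooth_fun_def)
  show "continuous_on UNIV \<psi>" "continuous_on UNIV (partial_deriv i \<psi>)"
    using *[of "[]"] *[of "[i]"]
    by (auto intro!: continuous_at_imp_continuous_on differentiable_imp_continuous_within)
qed

lemma partial_deriv_affine:
  fixes f :: "real^'n::finite \<Rightarrow> real"
  assumes "\<And>x. f differentiable (at x)"
  shows "partial_deriv i (\<lambda>x. f (t + c *\<^sub>R x)) = (\<lambda>x. c * partial_deriv i f (t + c *\<^sub>R x))"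
proof
  fix x
  have f: "(f has_derivative frechet_derivative f (at (t + c *\<^sub>R x))) (at (t + c *\<^sub>R x))"
    using assms frechet_derivative_works by blast
  have "((\<lambda>x. t + c *\<^sub>R x) has_derivative (\<lambda>y. c *\<^sub>R y)) (at x)"
    by (auto intro!: derivative_eq_intros)
  from has_derivative_compose[OF this f]
  have "frechet_derivative (\<lambda>x. f (t + c *\<^sub>R x)) (at x)
      = (\<lambda>y. frechet_derivative f (at (t + c *\<^sub>R x)) (c *\<^sub>R y))"
    by (rule frechet_derivative_at[symmetric])
  then show "partial_deriv i (\<lambda>x. f (t + c *\<^sub>R x)) x = c * partial_deriv i f (t + c *\<^sub>R x)"
    using linear_scale[OF has_derivative_linear[OF f]] by (simp add: partial_deriv_def)
qed

lemma test_fun_affine: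
  fixes \<psi> :: "real^'n::finite \<Rightarrow> real"
  assumes \<psi>: "test_fun \<psi>" and c: "c \<noteq> 0"
  shows "test_fun (\<lambda>x. \<psi> (t + c *\<^sub>R x))"
    and "partial_deriv i (\<lambda>x. \<psi> (t + c *\<^sub>R x)) = (\<lambda>x. c * partial_deriv i \<psi> (t + c *\<^sub>R x))"
proof -
  have d: "(foldr partial_deriv is \<psi>) differentiable (at x)" for "is" x
    using \<psi> by (simp add: test_fun_def smooth_fun_def)
  from partial_deriv_affine[OF d[of "[]"]]
  show "partial_deriv i (\<lambda>x. \<psi> (t + c *\<^sub>R x)) = (\<lambda>x. c * partial_deriv i \<psi> (t + c *\<^sub>R x))"
    by simp
  have cmult: "partial_deriv i (\<lambda>x. a * f x) = (\<lambda>x. a * partial_deriv i f x)"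
    if "\<And>x. f differentiable (at x)" for i a and f :: "real^'n \<Rightarrow> real"
  proof
    fix x
    have "((\<lambda>x. a * f x) has_derivative (\<lambda>y. a * frechet_derivative f (at x) y)) (at x)"
      by (intro has_derivative_mult_right) (use that frechet_derivative_works in blast)
    from frechet_derivative_at[OF this, symmetric]
    show "partial_deriv i (\<lambda>x. a * f x) x = a * partial_deriv i f x"
      by (simp add: partial_deriv_def)
  qed
  have aff: "(\<lambda>x. f (t + c *\<^sub>R x)) differentiable (at x)" if "\<And>x. f differentiable (at x)"
    for x and f :: "real^'n \<Rightarrow> real"
    by (rule differentiable_compose[of f]) (auto intro!: that derivative_intros)
  \<comment> \<open>Each partial derivative of the pullback contributes one factor c. With this
    closed form, smoothness is inherited from \<open>\<psi>\<close> at every order.\<close>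
  have *: "foldr partial_deriv is (\<lambda>x. \<psi> (t + c *\<^sub>R x)) =
      (\<lambda>x. c ^ length is * (foldr partial_deriv is \<psi>) (t + c *\<^sub>R x))" for "is"
  proof (induction "is")
    case (Cons i "is")
    have "foldr partial_deriv (i # is) (\<lambda>x. \<psi> (t + c *\<^sub>R x))
        = (\<lambda>x. c ^ length is * partial_deriv i (\<lambda>x. (foldr partial_deriv is \<psi>) (t + c *\<^sub>R x)) x)"
      using Cons by (simp add: cmult[OF aff[OF d]])
    also have "\<dots> = (\<lambda>x. c ^ length (i # is) * (foldr partial_deriv (i # is) \<psi>) (t + c *\<^sub>R x))"
      by (simp add: partial_deriv_affine[OF d] mult_ac)
    finally show ?case .
  qed simp
  have "smooth_fun (\<lambda>x. \<psi> (t + c *\<^sub>R x))"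
    unfolding smooth_fun_def * using aff[OF d] by (intro allI derivative_intros) auto
  moreover obtain R where R: "\<And>x. R < norm x \<Longrightarrow> \<psi> x = 0"
    using test_fun_supportE[OF \<psi>] by metis
  have "\<psi> (t + c *\<^sub>R x) = 0" if "(R + norm t) / \<bar>c\<bar> < norm x" for x
  proof (rule R)
    have "R + norm t < norm (c *\<^sub>R x)" using that c by (simp add: field_simps)
    also have "\<dots> \<le> norm (t + c *\<^sub>R x) + norm t"
      using norm_triangle_ineq2[of "c *\<^sub>R x" "- t"] by (simp add: add.commute)
    finally show "R < norm (t + c *\<^sub>R x)" by simp
  qed
  then have "compact (closure {x. \<psi> (t + c *\<^sub>R x) \<noteq> 0})"
    by (rule compact_closure_support)
  ultimately show "test_fun (\<lambda>x. \<psi> (t + c *\<^sub>R x))"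
    by (simp add: test_fun_def)
qed

lemma bump_eq_0_scaled:
  assumes "1 \<le> c * R" "0 < c" "R < \<bar>t\<bar>"
  shows "bump (c * t) = 0"
proof (rule bump_eq_0)
  have "1 < c * \<bar>t\<bar>"
    using assms by (meson le_less_trans mult_strict_left_mono)
  then show "1 \<le> \<bar>c * t\<bar>" using assms(2) by (simp add: abs_mult)
qed

lemma card_mult_Suc_ge_1: "1 \<le> real (CARD('n::finite) * Suc n)"
proof -
  have "real 1 \<le> real (CARD('n) * Suc n)"
    by (subst of_nat_le_iff) (simp add: Suc_le_eq)
  then show ?thesis by simp
qed

lemma bump_prod_facts:
  fixes x :: "real^'n::finite"
  shows "test_fun (bump_prod n :: real^'n \<Rightarrow> real)" "continuous_on UNIV (bump_prod n :: real^'n \<Rightarrow> real)"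
    "0 \<le> bump_prod n x" "1 / Suc n < norm x \<Longrightarrow> bump_prod n x = 0" "0 < bump_prod n (0 :: real^'n)"
proof -
  let ?N = "real (CARD('n) * Suc n)"
  have sm: "smooth_real (\<lambda>t. bump (?N * t))"
    using smooth_real_affine[OF smooth_bump, of 0 ?N] by simp
  have supp: "bump (?N * t) = 0" if "1 / ?N < \<bar>t\<bar>" for t
    using that card_mult_Suc_ge_1[where ?'n='n and n=n] by (intro bump_eq_0_scaled[of _ "1 / ?N"]) auto
  show t: "test_fun (bump_prod n :: real^'n \<Rightarrow> real)"
    unfolding bump_prod_def by (rule test_fun_coord_prod[OF sm supp])
  show "continuous_on UNIV (bump_prod n :: real^'n \<Rightarrow> real)"
    by (rule test_fun_continuous[OF t])
  show "0 \<le> bump_prod n x" by (auto simp: bump_prod_def coord_prod_def bump_nonneg intro!: prod_nonneg)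
  show "0 < bump_prod n (0 :: real^'n)" by (auto simp: bump_prod_def coord_prod_def bump_pos intro!: prod_pos)
  assume "1 / Suc n < norm x"
  moreover have "real CARD('n) * (1 / ?N) = 1 / Suc n"
    unfolding of_nat_mult by (simp del: of_nat_Suc)
  ultimately show "bump_prod n x = 0"
    unfolding bump_prod_def by (intro coord_prod_eq_0_norm[where R="1 / ?N"] supp) simp_all
qed

lemma bump_prod_integral_pos: "0 < (\<integral>y. bump_prod n (y :: real^'n::finite) \<partial>lborel)"
proof -
  let ?k = "bump_prod n :: real^'n \<Rightarrow> real"
  have int: "integrable lborel ?k"
    using bump_prod_facts(2,4) by (rule compact_support_integrable)
  have "0 \<le> (\<integral>y. ?k y \<partial>lborel)"
    by (intro Bochner_Integration.integral_nonneg bump_prod_facts(3))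
  moreover have "(\<integral>y. ?k y \<partial>lborel) \<noteq> 0"
  proof
    assume "(\<integral>y. ?k y \<partial>lborel) = 0"
    then have "AE y in lborel. ?k y = 0"
      using integral_nonneg_eq_0_iff_AE[OF int] bump_prod_facts(3) by auto
    \<comment> \<open>The zero set is closed and of full measure, so it contains every point, in
      particular the origin, where the bump is positive.\<close>
    then have "AE y in lebesgue. y \<in> {y. ?k y = 0}"
      by (auto intro: AE_completion)
    moreover have "closed {y. ?k y = 0}"
      by (intro closed_Collect_eq bump_prod_facts(2) continuous_intros)
    ultimately have "(0 :: real^'n) \<in> {y. ?k y = 0}"
      by (intro mem_closed_if_AE_lebesgue)
    then show False using bump_prod_facts(5)[of n] by (metis less_irrefl mem_Collect_eq)
  qed
  ultimately show ?thesis by simp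
qed

text \<open>The normalising constant is absorbed into one chosen factor, so that the normalised
  kernel is again a product. The index i is left free, because a later argument needs the constant
  in a prescribed direction.\<close>

lemma mollifier_seq_eq_coord_prod:
  fixes i :: "'n::finite"
  shows "(mollifier_seq n :: real^'n \<Rightarrow> real) = coord_prod
     (\<lambda>j t. (if j = i then 1 / (\<integral>y. bump_prod n (y :: real^'n) \<partial>lborel) else 1) *
        bump (real (CARD('n) * Suc n) * t))"
  unfolding coord_prod_cmult by (auto simp: mollifier_seq_def bump_prod_def)

lemma mollifier_mollifier_seq: "mollifier (1 / Suc n) (mollifier_seq n :: real^'n::finite \<Rightarrow> real)"
  unfolding mollifier_def mollifier_seq_def[abs_def]
  using bump_prod_facts bump_prod_integral_pos[of n, where ?'n='n]
  by (auto intro!: continuous_intros divide_nonneg_pos)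

text \<open>Taken as a function of y, the reflected kernel turns the value of a convolution at x
  into a pairing with a test function.\<close>

lemma test_fun_mollifier_seq:
  "test_fun (\<lambda>y. mollifier_seq n (x - y) :: real)" for x :: "real^'n::finite"
proof -
  have sm: "smooth_real (\<lambda>t. a * bump (c * t))" for a c
    using smooth_real_mult[OF smooth_real_const[of a] smooth_real_affine[OF smooth_bump, of 0 c]] by simp
  have "test_fun (mollifier_seq n :: real^'n \<Rightarrow> real)"
    unfolding mollifier_seq_eq_coord_prod[where i=undefined]
  proof (rule test_fun_coord_prod[where R=1])
    show "(if j = undefined then 1 / (\<integral>y. bump_prod n (y :: real^'n) \<partial>lborel) else 1) *
        bump (real (CARD('n) * Suc n) * t) = 0" if "1 < \<bar>t\<bar>" for j :: 'n and t
      using bump_eq_0_scaled[OF _ _ that, of "real (CARD('n) * Suc n)"] card_mult_Suc_ge_1[where ?'n='n and n=n]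
      by simp
  qed (rule sm)
  from test_fun_affine(1)[OF this, of "-1" x] show ?thesis by simp
qed

section \<open>Weak gradients\<close>

lemma square_integrable_imp_locally_integrable:
  assumes "square_integrable f"
  shows "locally_integrable f"
  unfolding locally_integrable_def
proof (intro allI impI)
  fix C :: "'a set" assume C: "compact C"
  have [measurable]: "f \<in> borel_measurable lebesgue" and f: "integrable lebesgue (\<lambda>x. (norm (f x))\<^sup>2)"
    using assms by (auto simp: square_integrable_def)
  have [measurable]: "C \<in> sets lebesgue" using C by (simp add: lmeasurable_compact fmeasurableD)
  have iC: "integrable lebesgue (indicator C :: 'a \<Rightarrow> real)"
    using C emeasure_bounded_finite[OF compact_imp_bounded[OF C]]
    by (subst integrable_completion) (auto simp: compact_imp_closed integrable_indicator_iff)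
  show "set_integrable lebesgue C f"
    unfolding set_integrable_def
  proof (rule Bochner_Integration.integrable_bound)
    show "integrable lebesgue (\<lambda>x. indicator C x + (norm (f x))\<^sup>2 :: real)"
      using iC f by (rule Bochner_Integration.integrable_add)
    have "t \<le> 1 + t\<^sup>2" if "0 \<le> t" for t :: real
      using sum_squares_bound[of 1 t] that unfolding power2_eq_square by linarith
    then show "AE x in lebesgue. norm (indicator C x *\<^sub>R f x) \<le> norm (indicator C x + (norm (f x))\<^sup>2 :: real)"
      by (auto simp: indicator_def)
  qed simp
qed

section \<open>Measurability and Borel representatives\<close>

lemma locally_integrable_borel_measurable:
  fixes f :: "'a::euclidean_space \<Rightarrow> 'b::euclidean_space"
  assumes "locally_integrable f"
  shows "f \<in> borel_measurable lebesgue"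
proof (rule borel_measurable_LIMSEQ_metric)
  show "(\<lambda>x. indicator (cball 0 (real n)) x *\<^sub>R f x) \<in> borel_measurable lebesgue" for n
    using assms[unfolded locally_integrable_def set_integrable_def, rule_format, of "cball 0 (real n)"]
    by (intro borel_measurable_integrable) simp
  fix x :: 'a
  obtain N where N: "norm x \<le> real N" using real_arch_simple by blast
  have "\<forall>\<^sub>F n in sequentially. f x = indicator (cball 0 (real n)) x *\<^sub>R f x"
    using eventually_ge_at_top[of N] by eventually_elim (use N in auto)
  then show "(\<lambda>n. indicator (cball 0 (real n)) x *\<^sub>R f x) \<longlonglongrightarrow> f x"
    by (rule Lim_transform_eventually[OF tendsto_const])
qed

text \<open>Bridges the completed measure of the definitions and the product measures over
  \<open>lborel\<close> used for Fubini. The real-valued case is applied to each coordinate.\<close>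

lemma lebesgue_AE_eq_borel:
  fixes f :: "'a::euclidean_space \<Rightarrow> 'b::euclidean_space"
  assumes [measurable]: "f \<in> borel_measurable lebesgue"
  shows "\<exists>f'\<in>borel_measurable borel. AE x in lebesgue. f x = f' x"
proof -
  have "\<forall>b\<in>Basis. \<exists>g\<in>borel_measurable lborel. AE x in lborel. f x \<bullet> b = g x"
    by (intro ballI completion_ex_borel_measurable_real) measurable
  then obtain g where g: "\<And>b. b \<in> Basis \<Longrightarrow> g b \<in> borel_measurable lborel"
      "\<And>b. b \<in> Basis \<Longrightarrow> AE x in lborel. f x \<bullet> b = g b x"
    by metis
  have "AE x in lborel. \<forall>b\<in>Basis. f x \<bullet> b = g b x"
    using g(2) by (intro AE_finite_allI) auto
  then have "AE x in lborel. f x = (\<Sum>b\<in>Basis. g b x *\<^sub>R b)"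
    by eventually_elim (metis (no_types, lifting) euclidean_representation sum.cong)
  then have ae: "AE x in lebesgue. f x = (\<Sum>b\<in>Basis. g b x *\<^sub>R b)"
    by (rule AE_completion)
  have "(\<lambda>x. \<Sum>b\<in>Basis. g b x *\<^sub>R b) \<in> borel_measurable borel"
    using g(1) by (auto intro!: borel_measurable_sum borel_measurable_scaleR)
  with ae show ?thesis by (rule bexI)
qed

lemma square_integrable_cong_AE:
  assumes "square_integrable f" "AE x in lebesgue. f x = g x" "g \<in> borel_measurable lebesgue"
  shows "square_integrable g"
proof -
  have "AE x in lebesgue. (norm (f x))\<^sup>2 = (norm (g x))\<^sup>2"
    using assms(2) by eventually_elim simp
  moreover have "(\<lambda>x. (norm (f x))\<^sup>2) \<in> borel_measurable lebesgue" "(\<lambda>x. (norm (g x))\<^sup>2) \<in> borel_measurable lebesgue"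
    using assms by (auto simp: square_integrable_def)
  ultimately show ?thesis
    using assms integrable_cong_AE[of "\<lambda>x. (norm (f x))\<^sup>2" lebesgue "\<lambda>x. (norm (g x))\<^sup>2"]
    unfolding square_integrable_def by auto
qed

lemma locally_integrable_cong_AE:
  assumes "locally_integrable f" "AE x in lebesgue. f x = g x" "g \<in> borel_measurable lebesgue"
  shows "locally_integrable g"
  unfolding locally_integrable_def
proof (intro allI impI)
  fix C :: "'a set" assume C: "compact C"
  have [measurable]: "C \<in> sets lebesgue" using C by (simp add: lmeasurable_compact fmeasurableD)
  have [measurable]: "f \<in> borel_measurable lebesgue" "g \<in> borel_measurable lebesgue"
    using locally_integrable_borel_measurable[OF assms(1)] assms(3) by auto
  have "integrable lebesgue (\<lambda>x. indicator C x *\<^sub>R f x)"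
    using assms(1) C by (auto simp: locally_integrable_def set_integrable_def)
  moreover have "AE x in lebesgue. indicator C x *\<^sub>R f x = indicator C x *\<^sub>R g x"
    using assms(2) by eventually_elim simp
  ultimately show "set_integrable lebesgue C g"
    unfolding set_integrable_def by (subst integrable_cong_AE[symmetric]) auto
qed

lemma has_weak_gradient_cong_AE:
  fixes f :: "real^'n::finite \<Rightarrow> complex"
  assumes fg: "has_weak_gradient f g"
    and f': "AE x in lebesgue. f x = f' x" "f' \<in> borel_measurable lebesgue"
    and g': "AE x in lebesgue. g x = g' x" "g' \<in> borel_measurable lebesgue"
  shows "has_weak_gradient f' g'"
proof -
  have li: "locally_integrable f" "locally_integrable g" "locally_integrable f'" "locally_integrable g'"
    using fg f' g' by (auto simp: has_weak_gradient_def intro: locally_integrable_cong_AE)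
  note [measurable] = li[THEN locally_integrable_borel_measurable]
  have [measurable]: "(\<lambda>x. h x $ i) \<in> borel_measurable lebesgue"
    if "h \<in> borel_measurable lebesgue" for h :: "real^'n \<Rightarrow> complex^'n" and i
    by (rule measurable_compose[OF that borel_measurable_continuous_onI]) (intro continuous_intros)
  show ?thesis
    unfolding has_weak_gradient_def
  proof (intro conjI li allI impI)
    fix \<psi> :: "real^'n \<Rightarrow> real" and i assume \<psi>: "test_fun \<psi>"
    have [measurable]: "\<psi> \<in> borel_measurable lebesgue" "partial_deriv i \<psi> \<in> borel_measurable lebesgue"
      using test_fun_continuous[OF \<psi>] by (simp_all add: measurable_completion borel_measurable_continuous_onI)
    have "(LINT x|lebesgue. partial_deriv i \<psi> x *\<^sub>R f' x) = (LINT x|lebesgue. partial_deriv i \<psi> x *\<^sub>R f x)"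
      using f'(1) by (intro integral_cong_AE) (auto elim!: eventually_mono)
    also have "\<dots> = - (LINT x|lebesgue. \<psi> x *\<^sub>R (g x $ i))"
      using fg \<psi> by (simp add: has_weak_gradient_def)
    also have "(LINT x|lebesgue. \<psi> x *\<^sub>R (g x $ i)) = (LINT x|lebesgue. \<psi> x *\<^sub>R (g' x $ i))"
      using g'(1) by (intro integral_cong_AE) (auto elim!: eventually_mono)
    finally show "(LINT x|lebesgue. partial_deriv i \<psi> x *\<^sub>R f' x) = - (LINT x|lebesgue. \<psi> x *\<^sub>R (g' x $ i))" .
  qed
qed

section \<open>Fundamental lemma of the calculus of variations and uniqueness of weak
  gradients\<close>

lemma mollifier_seq_eq_0: "1 < norm x \<Longrightarrow> mollifier_seq n (x :: real^'n::finite) = 0"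
proof -
  assume "1 < norm x"
  moreover have "1 / Suc n \<le> (1::real)" by simp
  ultimately have "1 / Suc n < norm x" by linarith
  then show ?thesis using mollifier_mollifier_seq[of n] unfolding mollifier_def by blast
qed

text \<open>The L^1 result is applied to the cut-off of f to the ball of radius R. All kernels live
  in the unit ball, so at points of norm at most \<open>R - 1\<close> the cut-off does not change
  the convolution.\<close>

lemma convolve_mollifier_seq_AE:
  fixes f :: "real^'n::finite \<Rightarrow> 'b::euclidean_space"
  assumes [measurable]: "f \<in> borel_measurable borel" and f: "integrable lborel (\<lambda>x. indicator (cball 0 R) x *\<^sub>R f x)"
  shows "\<exists>s. strict_mono s \<and>
    (AE x in lborel. norm x \<le> R - 1 \<longrightarrow> (\<lambda>n. convolve (mollifier_seq (s n)) f x) \<longlonglongrightarrow> f x)"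
proof -
  let ?f = "\<lambda>x. indicator (cball 0 R) x *\<^sub>R f x"
  have eq: "convolve (mollifier_seq n) ?f x = convolve (mollifier_seq n) f x" if "norm x \<le> R - 1" for n x
    unfolding convolve_def
  proof (rule Bochner_Integration.integral_cong)
    fix y
    show "mollifier_seq n (x - y) *\<^sub>R ?f y = mollifier_seq n (x - y) *\<^sub>R f y"
    proof (cases "norm y \<le> R")
      case False
      then have "1 < norm (x - y)"
        using that norm_triangle_ineq2[of y x] by (simp add: norm_minus_commute)
      then show ?thesis by (simp add: mollifier_seq_eq_0)
    qed simp
  qed simp
  obtain s where s: "strict_mono s" "AE x in lborel. (\<lambda>n. convolve (mollifier_seq (s n)) ?f x) \<longlonglongrightarrow> ?f x"
    using convolve_AE_subseq[OF f mollifier_mollifier_seq LIMSEQ_Suc[OF lim_1_over_n]] by auto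
  from s(2) have "AE x in lborel. norm x \<le> R - 1 \<longrightarrow> (\<lambda>n. convolve (mollifier_seq (s n)) f x) \<longlonglongrightarrow> f x"
  proof eventually_elim
    case (elim x)
    show ?case
    proof
      assume x: "norm x \<le> R - 1"
      then have "?f x = f x" by simp
      with elim x show "(\<lambda>n. convolve (mollifier_seq (s n)) f x) \<longlonglongrightarrow> f x" by (simp add: eq)
    qed
  qed
  with s(1) show ?thesis by blast
qed

lemma integrable_lborel_cball:
  fixes f :: "'a::euclidean_space \<Rightarrow> 'b::euclidean_space"
  assumes "locally_integrable f" and [measurable]: "f \<in> borel_measurable borel"
  shows "integrable lborel (\<lambda>x. indicator (cball 0 R) x *\<^sub>R f x)"
proof -
  have "integrable lebesgue (\<lambda>x. indicator (cball 0 R) x *\<^sub>R f x)"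
    using assms(1) by (auto simp: locally_integrable_def set_integrable_def)
  moreover have "(\<lambda>x. indicator (cball 0 R) x *\<^sub>R f x) \<in> borel_measurable borel"
    using assms(2) by (intro borel_measurable_scaleR borel_measurable_indicator) auto
  ultimately show ?thesis by (subst (asm) integrable_completion) simp_all
qed

lemma convolve_mollifier_seq_eq_0_imp_AE:
  fixes f :: "real^'n::finite \<Rightarrow> 'b::euclidean_space"
  assumes f: "locally_integrable f" "f \<in> borel_measurable borel"
    and 0: "\<And>n x. convolve (mollifier_seq n) f x = 0"
  shows "AE x in lborel. f x = 0"
proof -
  have "AE x in lborel. norm x \<le> real N - 1 \<longrightarrow> f x = 0" for N
  proof -
    obtain s where "AE x in lborel. norm x \<le> real N - 1 \<longrightarrow> (\<lambda>n. convolve (mollifier_seq (s n)) f x) \<longlonglongrightarrow> f x"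
      using convolve_mollifier_seq_AE[OF f(2) integrable_lborel_cball[OF f], of "real N"] by auto
    then show ?thesis
      by eventually_elim (auto simp: 0 LIMSEQ_const_iff)
  qed
  then have "AE x in lborel. \<forall>N. norm x \<le> real N - 1 \<longrightarrow> f x = 0"
    by (simp only: AE_all_countable) blast
  then show ?thesis
  proof eventually_elim
    case (elim x)
    obtain N where "norm x + 1 \<le> real N" using real_arch_simple by blast
    with elim show ?case by (auto simp: le_diff_eq)
  qed
qed

lemma test_fun_scaleR_integrable:
  fixes f :: "real^'n::finite \<Rightarrow> 'b::euclidean_space"
  assumes f: "locally_integrable f" and \<psi>: "test_fun \<psi>"
  shows "integrable lebesgue (\<lambda>x. \<psi> x *\<^sub>R f x)" "integrable lebesgue (\<lambda>x. partial_deriv i \<psi> x *\<^sub>R f x)"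
proof -
  have *: "integrable lebesgue (\<lambda>x. k x *\<^sub>R f x)"
    if kc: "continuous_on UNIV k" and k0: "\<And>x. R < norm x \<Longrightarrow> k x = 0" for k :: "real^'n \<Rightarrow> real" and R
  proof -
    obtain M where M: "0 < M" "\<And>x. \<bar>k x\<bar> \<le> M"
      using compact_support_bounded[OF kc k0] by blast
    have [measurable]: "f \<in> borel_measurable lebesgue" "k \<in> borel_measurable lebesgue"
      using kc locally_integrable_borel_measurable[OF f]
      by (simp_all add: measurable_completion borel_measurable_continuous_onI)
    have int: "integrable lebesgue (\<lambda>x. indicator (cball 0 R) x *\<^sub>R f x)"
      using f by (auto simp: locally_integrable_def set_integrable_def)
    show ?thesis
    proof (rule Bochner_Integration.integrable_bound)
      show "integrable lebesgue (\<lambda>x. M * norm (indicator (cball 0 R) x *\<^sub>R f x))"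
        using int by (intro integrable_mult_right integrable_norm)
      show "AE x in lebesgue. norm (k x *\<^sub>R f x) \<le> norm (M * norm (indicator (cball 0 R) x *\<^sub>R f x))"
      proof (rule AE_I2)
        fix x
        show "norm (k x *\<^sub>R f x) \<le> norm (M * norm (indicator (cball 0 R) x *\<^sub>R f x))"
          using M k0[of x] by (cases "norm x \<le> R") (auto simp: abs_mult intro!: mult_right_mono)
      qed
    qed measurable
  qed
  obtain R where R: "\<And>x. R < norm x \<Longrightarrow> \<psi> x = 0" "\<And>x i. R < norm x \<Longrightarrow> partial_deriv i \<psi> x = 0"
    using test_fun_supportE[OF \<psi>] by metis
  show "integrable lebesgue (\<lambda>x. \<psi> x *\<^sub>R f x)"
    by (rule *[OF test_fun_continuous(1)[OF \<psi>] R(1)])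
  show "integrable lebesgue (\<lambda>x. partial_deriv i \<psi> x *\<^sub>R f x)"
    by (rule *[OF test_fun_continuous(2)[OF \<psi>] R(2)])
qed

text \<open>Convolving the difference of two gradients with a mollifier is pairing it with a test
  function, which gives 0 since both pairings come from the same f. This makes integrals of the
  chosen \<open>weak_gradient\<close> computable from any weak gradient at hand.\<close>

lemma has_weak_gradient_unique:
  assumes g: "has_weak_gradient f g" and h: "has_weak_gradient f h"
  shows "AE x in lebesgue. g x = h x"
proof -
  have lg: "locally_integrable g" "locally_integrable h"
    using g h by (auto simp: has_weak_gradient_def)
  have lw: "locally_integrable (\<lambda>x. g x - h x)"
    using lg by (auto simp: locally_integrable_def)
  obtain w where w [measurable]: "w \<in> borel_measurable borel" and gw: "AE x in lebesgue. g x - h x = w x"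
    using lebesgue_AE_eq_borel[OF locally_integrable_borel_measurable[OF lw]] by auto
  have wl [measurable]: "w \<in> borel_measurable lebesgue" using w by (simp add: measurable_completion)
  have [measurable]: "(\<lambda>x. g x - h x) \<in> borel_measurable lebesgue"
    by (rule locally_integrable_borel_measurable[OF lw])
  have lw': "locally_integrable w"
    by (rule locally_integrable_cong_AE[OF lw gw wl])
  have "convolve (mollifier_seq n) w x = 0" for n x
  proof -
    let ?\<psi> = "\<lambda>y. mollifier_seq n (x - y) :: real"
    note \<psi> = test_fun_mollifier_seq[of n x]
    have [measurable]: "?\<psi> \<in> borel_measurable borel"
      using test_fun_continuous(1)[OF \<psi>] by (rule borel_measurable_continuous_onI)
    have ml: "?\<psi> \<in> borel_measurable lebesgue" by (simp add: measurable_completion)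
    note int = test_fun_scaleR_integrable(1)[OF lg(1) \<psi>] test_fun_scaleR_integrable(1)[OF lg(2) \<psi>]
    have comp: "(LINT y|lebesgue. ?\<psi> y *\<^sub>R (g y $ i)) = (LINT y|lebesgue. ?\<psi> y *\<^sub>R (h y $ i))" for i
    proof -
      have "(LINT y|lebesgue. partial_deriv i ?\<psi> y *\<^sub>R f y) = - (LINT y|lebesgue. ?\<psi> y *\<^sub>R (g y $ i))"
        using g \<psi> unfolding has_weak_gradient_def by blast
      moreover have "(LINT y|lebesgue. partial_deriv i ?\<psi> y *\<^sub>R f y) = - (LINT y|lebesgue. ?\<psi> y *\<^sub>R (h y $ i))"
        using h \<psi> unfolding has_weak_gradient_def by blast
      ultimately show ?thesis by simp
    qed
    have nth: "(LINT y|lebesgue. ?\<psi> y *\<^sub>R (u y $ i)) = (LINT y|lebesgue. ?\<psi> y *\<^sub>R u y) $ i"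
      if "integrable lebesgue (\<lambda>y. ?\<psi> y *\<^sub>R u y)" for u :: "real^'a \<Rightarrow> complex^'a" and i
      using integral_bounded_linear[OF bounded_linear_vec_nth that, of i] by simp
    have "(LINT y|lebesgue. ?\<psi> y *\<^sub>R g y) = (LINT y|lebesgue. ?\<psi> y *\<^sub>R h y)"
      using comp by (simp add: vec_eq_iff nth int)
    then have "0 = (LINT y|lebesgue. ?\<psi> y *\<^sub>R (g y - h y))"
      using int by (simp add: scaleR_right_diff_distrib)
    also have "\<dots> = (LINT y|lebesgue. ?\<psi> y *\<^sub>R w y)"
    proof (rule integral_cong_AE)
      show "AE y in lebesgue. ?\<psi> y *\<^sub>R (g y - h y) = ?\<psi> y *\<^sub>R w y"
        using gw by eventually_elim simp
      show "(\<lambda>y. ?\<psi> y *\<^sub>R (g y - h y)) \<in> borel_measurable lebesgue"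
        by (rule borel_measurable_scaleR[OF ml locally_integrable_borel_measurable[OF lw]])
      show "(\<lambda>y. ?\<psi> y *\<^sub>R w y) \<in> borel_measurable lebesgue"
        by (rule borel_measurable_scaleR[OF ml wl])
    qed
    also have "\<dots> = convolve (mollifier_seq n) w x"
      unfolding convolve_def by (rule integral_completion) measurable
    finally show ?thesis by simp
  qed
  then have "AE x in lborel. w x = 0"
    using lw' w by (intro convolve_mollifier_seq_eq_0_imp_AE)
  then have "AE x in lebesgue. w x = 0" by (rule AE_completion)
  with gw show ?thesis by eventually_elim simp
qed

section \<open>Mollification and scaling of weak gradients\<close>

lemma convolve_reflect:
  assumes k: "mollifier r k" and [measurable]: "f \<in> borel_measurable borel"
  shows "convolve k f x = (\<integral>z. k z *\<^sub>R f (x - z) \<partial>lborel)"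
proof -
  note [measurable] = mollifier_borel[OF k]
  show ?thesis
    using integral_lborel_reflect(1)[of "\<lambda>y. k (x - y) *\<^sub>R f y" x] by (simp add: convolve_def)
qed

text \<open>Fubini. The double integrand is dominated through \<open>\<bar>a x\<bar> * norm (f (x -
  z)) \<le> (a x)\<^sup>2 + (norm (f (x - z)))\<^sup>2\<close>, whose x-integral is the constant C
  for every z by translation invariance.\<close>

lemma integral_scaleR_convolve:
  fixes f :: "'a::euclidean_space \<Rightarrow> 'b::euclidean_space"
  assumes k: "mollifier r k"
    and f [measurable]: "f \<in> borel_measurable borel" and f2: "integrable lborel (\<lambda>x. (norm (f x))\<^sup>2)"
    and a: "continuous_on UNIV a" "\<And>x. R < norm x \<Longrightarrow> a x = 0"
  shows "(\<integral>x. a x *\<^sub>R convolve k f x \<partial>lborel) = (\<integral>z. k z *\<^sub>R (\<integral>x. a x *\<^sub>R f (x - z) \<partial>lborel) \<partial>lborel)"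
proof -
  note [measurable] = mollifier_borel[OF k] borel_measurable_continuous_onI[OF a(1)]
  have a2: "integrable lborel (\<lambda>x. (a x)\<^sup>2)"
    using a by (intro compact_support_integrable[where r=R]) (auto intro!: continuous_intros)
  define C where "C = (\<integral>x. (a x)\<^sup>2 \<partial>lborel) + (\<integral>x. (norm (f x))\<^sup>2 \<partial>lborel)"
  have "integrable (lborel \<Otimes>\<^sub>M lborel) (\<lambda>(x, z). (a x * k z) *\<^sub>R f (x - z))"
  proof (rule integrableI_bounded)
    have "(\<integral>\<^sup>+p. norm (case p of (x, z) \<Rightarrow> (a x * k z) *\<^sub>R f (x - z)) \<partial>(lborel \<Otimes>\<^sub>M lborel))
       = (\<integral>\<^sup>+z. \<integral>\<^sup>+x. norm ((a x * k z) *\<^sub>R f (x - z)) \<partial>lborel \<partial>lborel)"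
      by (subst lborel_pair.nn_integral_snd[symmetric]) auto
    also have "\<dots> \<le> (\<integral>\<^sup>+z. ennreal (k z) * ennreal C \<partial>lborel)"
    proof (rule nn_integral_mono)
      fix z
      have "(\<integral>\<^sup>+x. norm ((a x * k z) *\<^sub>R f (x - z)) \<partial>lborel)
         \<le> (\<integral>\<^sup>+x. ennreal (k z) * (ennreal ((a x)\<^sup>2) + ennreal ((norm (f (x - z)))\<^sup>2)) \<partial>lborel)"
      proof (rule nn_integral_mono)
        fix x
        have "\<bar>a x\<bar> * norm (f (x - z)) \<le> (a x)\<^sup>2 + (norm (f (x - z)))\<^sup>2"
          using sum_squares_bound[of "\<bar>a x\<bar>" "norm (f (x - z))"]
            mult_nonneg_nonneg[OF abs_ge_zero[of "a x"] norm_ge_zero[of "f (x - z)"]]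
          unfolding power2_abs by linarith
        then have "k z * (\<bar>a x\<bar> * norm (f (x - z))) \<le> k z * ((a x)\<^sup>2 + (norm (f (x - z)))\<^sup>2)"
          by (intro mult_left_mono mollifier_nonneg[OF k])
        then have "ennreal (norm ((a x * k z) *\<^sub>R f (x - z))) \<le> ennreal (k z * ((a x)\<^sup>2 + (norm (f (x - z)))\<^sup>2))"
          by (intro ennreal_leI) (simp add: abs_mult mollifier_nonneg[OF k] mult_ac)
        then show "ennreal (norm ((a x * k z) *\<^sub>R f (x - z)))
          \<le> ennreal (k z) * (ennreal ((a x)\<^sup>2) + ennreal ((norm (f (x - z)))\<^sup>2))"
          by (simp add: ennreal_mult mollifier_nonneg[OF k])
      qed
      also have "\<dots> = ennreal (k z) * ennreal C"
        using nn_integral_lborel_reflect(2)[of "\<lambda>x. ennreal ((norm (f x))\<^sup>2)" z]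
        by (simp add: nn_integral_cmult nn_integral_add nn_integral_eq_integral a2 f2 C_def)
      finally show "(\<integral>\<^sup>+x. norm ((a x * k z) *\<^sub>R f (x - z)) \<partial>lborel) \<le> ennreal (k z) * ennreal C" .
    qed
    also have "\<dots> < \<infinity>"
      by (simp add: nn_integral_multc mollifier_nn_integral[OF k])
    finally show "(\<integral>\<^sup>+p. norm (case p of (x, z) \<Rightarrow> (a x * k z) *\<^sub>R f (x - z)) \<partial>(lborel \<Otimes>\<^sub>M lborel)) < \<infinity>" .
  qed simp
  from lborel_pair.Fubini_integral[OF this]
  have "(\<integral>z. \<integral>x. k z *\<^sub>R a x *\<^sub>R f (x - z) \<partial>lborel \<partial>lborel) = (\<integral>x. \<integral>z. a x *\<^sub>R k z *\<^sub>R f (x - z) \<partial>lborel \<partial>lborel)"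
    by (simp add: mult_ac)
  then show ?thesis
    by (simp add: convolve_reflect[OF k f] flip: integral_scaleR_right)
qed

lemma convolve_has_weak_gradient:
  fixes f :: "real^'n::finite \<Rightarrow> complex"
  assumes k: "mollifier r k" and fg: "has_weak_gradient f g"
    and f [measurable]: "f \<in> borel_measurable borel" and f2: "integrable lborel (\<lambda>x. (norm (f x))\<^sup>2)"
    and g [measurable]: "g \<in> borel_measurable borel" and g2: "integrable lborel (\<lambda>x. (norm (g x))\<^sup>2)"
  shows "has_weak_gradient (convolve k f) (convolve k g)"
    and "square_integrable (convolve k f)" "square_integrable (convolve k g)"
proof -
  note [measurable] = borel_measurable_convolve[OF k f] borel_measurable_convolve[OF k g] mollifier_borel[OF k]
  show sq: "square_integrable (convolve k f)" "square_integrable (convolve k g)"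
    using convolve_square_integrable(1)[OF k f f2] convolve_square_integrable(1)[OF k g g2]
    by (auto simp: square_integrable_def integrable_completion measurable_completion)
  show "has_weak_gradient (convolve k f) (convolve k g)"
    unfolding has_weak_gradient_def
  proof (intro conjI allI impI sq[THEN square_integrable_imp_locally_integrable])
    fix \<psi> :: "real^'n \<Rightarrow> real" and i assume \<psi>: "test_fun \<psi>"
    obtain R where R: "\<And>x. R < norm x \<Longrightarrow> \<psi> x = 0" "\<And>x i. R < norm x \<Longrightarrow> partial_deriv i \<psi> x = 0"
      using test_fun_supportE[OF \<psi>] by metis
    note c = test_fun_continuous[OF \<psi>]
    note [measurable] = c[THEN borel_measurable_continuous_onI]
    have gi [measurable]: "(\<lambda>x. g x $ i) \<in> borel_measurable borel"
      by (rule measurable_compose[OF g borel_measurable_continuous_onI]) (intro continuous_intros)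
    have gi2: "integrable lborel (\<lambda>x. (norm (g x $ i))\<^sup>2)"
      using g2 by (rule Bochner_Integration.integrable_bound)
        (auto intro!: AE_I2 power_mono Finite_Cartesian_Product.norm_nth_le)
    have nth: "convolve k g x $ i = convolve k (\<lambda>x. g x $ i) x" for x
      unfolding convolve_def
      using integral_bounded_linear[OF bounded_linear_vec_nth integrable_convolve_square(2)[OF k g g2, of x], of i]
      by simp
    \<comment> \<open>For fixed z the shift is transferred from f to the test function, whose
      translate is again a test function. Averaging this identity over z with weight
      \<open>k z\<close> then shows that convolution commutes with the weak gradient.\<close>
    have inner: "(\<integral>x. partial_deriv i \<psi> x *\<^sub>R f (x - z) \<partial>lborel) = - (\<integral>x. \<psi> x *\<^sub>R (g (x - z) $ i) \<partial>lborel)" for z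
    proof -
      have "(\<integral>x. partial_deriv i \<psi> x *\<^sub>R f (x - z) \<partial>lborel) = (\<integral>x. partial_deriv i \<psi> (z + x) *\<^sub>R f x \<partial>lborel)"
        using integral_lborel_translate(1)[of "\<lambda>x. partial_deriv i \<psi> (z + x) *\<^sub>R f x" z] by simp
      also have "\<dots> = (LINT x|lebesgue. partial_deriv i (\<lambda>x. \<psi> (z + 1 *\<^sub>R x)) x *\<^sub>R f x)"
        by (subst test_fun_affine(2)[OF \<psi>]) (simp_all add: integral_completion)
      also have "\<dots> = - (LINT x|lebesgue. \<psi> (z + 1 *\<^sub>R x) *\<^sub>R (g x $ i))"
        using fg test_fun_affine(1)[OF \<psi> one_neq_zero, of z] unfolding has_weak_gradient_def by blast
      also have "(LINT x|lebesgue. \<psi> (z + 1 *\<^sub>R x) *\<^sub>R (g x $ i)) = (\<integral>x. \<psi> (z + x) *\<^sub>R (g x $ i) \<partial>lborel)"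
        by (simp add: integral_completion)
      also have "\<dots> = (\<integral>x. \<psi> x *\<^sub>R (g (x - z) $ i) \<partial>lborel)"
        using integral_lborel_translate(1)[of "\<lambda>x. \<psi> (z + x) *\<^sub>R (g x $ i)" z] by simp
      finally show ?thesis .
    qed
    have "(LINT x|lebesgue. partial_deriv i \<psi> x *\<^sub>R convolve k f x)
        = (\<integral>x. partial_deriv i \<psi> x *\<^sub>R convolve k f x \<partial>lborel)"
      by (rule integral_completion) measurable
    also have "\<dots> = (\<integral>z. k z *\<^sub>R (\<integral>x. partial_deriv i \<psi> x *\<^sub>R f (x - z) \<partial>lborel) \<partial>lborel)"
      by (rule integral_scaleR_convolve[OF k f f2 c(2) R(2)])
    also have "\<dots> = - (\<integral>z. k z *\<^sub>R (\<integral>x. \<psi> x *\<^sub>R (g (x - z) $ i) \<partial>lborel) \<partial>lborel)"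
      by (simp add: inner)
    also have "\<dots> = - (\<integral>x. \<psi> x *\<^sub>R convolve k (\<lambda>x. g x $ i) x \<partial>lborel)"
      by (subst integral_scaleR_convolve[OF k gi gi2 c(1) R(1)]) simp_all
    also have "\<dots> = - (LINT x|lebesgue. \<psi> x *\<^sub>R (convolve k g x $ i))"
      unfolding nth using borel_measurable_convolve[OF k gi]
      by (subst integral_completion) simp_all
    finally show "(LINT x|lebesgue. partial_deriv i \<psi> x *\<^sub>R convolve k f x)
        = - (LINT x|lebesgue. \<psi> x *\<^sub>R (convolve k g x $ i))" .
  qed
qed

section \<open>Square integrable functions with vanishing weak gradient\<close>

lemma bump_primitive:
  obtains F :: "real \<Rightarrow> real" where "\<And>x. (F has_real_derivative bump x) (at x)"
    "\<And>x. 1 \<le> x \<Longrightarrow> F x = F 1" "\<And>x. x \<le> -1 \<Longrightarrow> F x = F (-1)"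
proof -
  have "\<exists>F. \<forall>x::real. -\<infinity> < ereal x \<longrightarrow> ereal x < \<infinity> \<longrightarrow> (F has_vector_derivative bump x) (at x)"
    by (rule einterval_antiderivative)
       (use smooth_real_continuous[OF smooth_bump] in \<open>auto simp: continuous_on_eq_continuous_at\<close>)
  then obtain F where F: "\<And>x. (F has_real_derivative bump x) (at x)"
    by (auto simp: has_real_derivative_iff_has_vector_derivative)
  have const: "\<exists>c. \<forall>x\<in>S. F x = c" if "convex S" "\<And>x. x \<in> S \<Longrightarrow> 1 \<le> \<bar>x\<bar>" for S
    using that F[THEN has_field_derivative_at_within] bump_eq_0
    by (intro has_field_derivative_zero_constant) (auto, metis)
  obtain c where "\<And>x. x \<in> {1..} \<Longrightarrow> F x = c" using const[of "{1..}"] by auto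
  moreover obtain d where "\<And>x. x \<in> {..-1} \<Longrightarrow> F x = d" using const[of "{..-1}"] by auto
  ultimately show ?thesis using F that[of F] by auto
qed

text \<open>A difference of two translates of the mollifier along a coordinate axis is a partial
  derivative of a test function, because it has integral zero along that axis.\<close>

lemma mollifier_seq_diff_partial_deriv:
  fixes x :: "real^'n::finite"
  obtains \<psi> where "test_fun \<psi>"
    "\<And>y. partial_deriv i \<psi> y = mollifier_seq n (x + h *\<^sub>R axis i 1 - y) - mollifier_seq n (x - y)"
proof -
  define N where "N = real (CARD('n) * Suc n)"
  have N: "1 \<le> N" "0 < N" using card_mult_Suc_ge_1[where ?'n='n and n=n] by (auto simp: N_def)
  define c where "c = 1 / (\<integral>y. bump_prod n (y :: real^'n) \<partial>lborel)"
  obtain F where F: "\<And>x. (F has_real_derivative bump x) (at x)"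
    "\<And>x. 1 \<le> x \<Longrightarrow> F x = F 1" "\<And>x. x \<le> -1 \<Longrightarrow> F x = F (-1)"
    using bump_primitive by blast
  \<comment> \<open>The i-th factor is a primitive of D, the i-th factor of the difference of
    kernels. One shifted copy of F has different constants at the two ends, so only the difference
    of two copies has compact support. The scalar \<open>- c / N\<close> carries the normalisation
    and cancels the inner derivative -N.\<close>
  define H where "H j t = (if j = i then (- c / N) * (F (N * (x $ i + h) + - N * t) + (-1) * F (N * x $ i + - N * t))
      else bump (N * x $ j + - N * t))" for j t
  define D where "D t = c * (bump (N * (x $ i + h - t)) - bump (N * (x $ i - t)))" for t
  have smF: "smooth_real F" by (rule smooth_real_primitive[OF smooth_bump F(1)])
  have smH: "smooth_real (H j)" for j
    unfolding H_def[abs_def]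
    by (cases "j = i")
       (simp_all only: if_True if_False refl, intro smooth_real_mult smooth_real_add smooth_real_const
         smooth_real_affine[OF smF], intro smooth_real_affine[OF smooth_bump])
  have "(H i has_real_derivative D t) (at t)" for t
  proof -
    have 1: "((\<lambda>t. F (a + - N * t)) has_real_derivative bump (a + - N * t) * (- N)) (at t)" for a
      by (rule DERIV_chain2[OF F(1)]) (auto intro!: derivative_eq_intros)
    have "((\<lambda>t. (- c / N) * (F (N * (x $ i + h) + - N * t) + (-1) * F (N * x $ i + - N * t))) has_real_derivative
      (- c / N) * (bump (N * (x $ i + h) + - N * t) * (- N) + (-1) * (bump (N * x $ i + - N * t) * (- N)))) (at t)"
      by (intro DERIV_cmult DERIV_add 1)
    moreover have "(- c / N) * (bump (N * (x $ i + h) + - N * t) * (- N) + (-1) * (bump (N * x $ i + - N * t) * (- N))) = D t"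
      using N(2) by (simp add: D_def algebra_simps)
    ultimately show ?thesis by (simp add: H_def[abs_def])
  qed
  then have dH: "deriv (H i) = D" by (auto intro: DERIV_imp_deriv)
  have abs_le: "1 \<le> N * s" if "1 \<le> s" for s using mult_mono[of 1 N 1 s] N that by simp
  \<comment> \<open>Since \<open>1 \<le> N\<close> and
    \<open>\<bar>x $ k\<bar> \<le> norm x\<close>, beyond this radius the arguments of both copies
    of F lie on the same side of [-1, 1], where F is constant, so the copies cancel.\<close>
  have supp: "H j t = 0" if t: "norm x + \<bar>h\<bar> + 1 < \<bar>t\<bar>" for j t
  proof -
    have xj: "\<bar>x $ k\<bar> \<le> norm x" for k using component_le_norm_cart .
    consider "norm x + \<bar>h\<bar> + 1 < t" | "t < - (norm x + \<bar>h\<bar> + 1)" using t by linarith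
    then show ?thesis
    proof cases
      case 1
      have "1 \<le> t - x $ k" "1 \<le> t - (x $ k + h)" for k using 1 xj[of k] by linarith+
      from this[THEN abs_le]
      have *: "N * x $ k + - N * t \<le> -1" "N * (x $ k + h) + - N * t \<le> -1" for k
        by (simp_all add: algebra_simps)
      have "bump (N * x $ j + - N * t) = 0"
        by (rule bump_eq_0) (use *(1)[of j] in linarith)
      with F(3)[OF *(1)] F(3)[OF *(2)] show ?thesis
        unfolding H_def by simp
    next
      case 2
      have "1 \<le> x $ k - t" "1 \<le> (x $ k + h) - t" for k using 2 xj[of k] by linarith+
      from this[THEN abs_le]
      have *: "1 \<le> N * x $ k + - N * t" "1 \<le> N * (x $ k + h) + - N * t" for k
        by (simp_all add: algebra_simps)
      have "bump (N * x $ j + - N * t) = 0"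
        by (rule bump_eq_0) (use *(1)[of j] in linarith)
      with F(2)[OF *(1)] F(2)[OF *(2)] show ?thesis
        unfolding H_def by simp
    qed
  qed
  have "test_fun (coord_prod H)"
    by (rule test_fun_coord_prod[OF smH supp])
  moreover have "partial_deriv i (coord_prod H) y
      = mollifier_seq n (x + h *\<^sub>R axis i 1 - y) - mollifier_seq n (x - y)" for y
  proof -
    have m: "mollifier_seq n z = c * bump (N * z $ i) * (\<Prod>j\<in>UNIV - {i}. bump (N * z $ j))" for z :: "real^'n"
      unfolding mollifier_seq_eq_coord_prod[where i=i] coord_prod_def
      by (subst prod.remove[of _ i]) (auto simp: c_def N_def intro!: prod.cong)
    have "partial_deriv i (coord_prod H) y = coord_prod (H(i := D)) y"
      by (subst partial_deriv_coord_prod[OF smooth_real_derivD(1)[OF smH]]) (simp add: dH)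
    also have "\<dots> = D (y $ i) * (\<Prod>j\<in>UNIV - {i}. bump (N * (x - y) $ j))"
      unfolding coord_prod_def
      by (subst prod.remove[of _ i]) (auto simp: H_def algebra_simps intro!: prod.cong)
    also have "\<dots> = mollifier_seq n (x + h *\<^sub>R axis i 1 - y) - mollifier_seq n (x - y)"
    proof -
      have "(\<Prod>j\<in>UNIV - {i}. bump (N * (x + h *\<^sub>R axis i 1 - y) $ j)) = (\<Prod>j\<in>UNIV - {i}. bump (N * (x - y) $ j))"
        by (intro prod.cong) (auto simp: axis_def)
      then show ?thesis
        unfolding m D_def by (simp add: axis_def algebra_simps)
    qed
    finally show ?thesis .
  qed
  ultimately show ?thesis using that by blast
qed

text \<open>A difference of two values of the mollified function along an axis pairs f with a
  partial derivative of a test function, hence vanishes. The mollified function is thus constant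
  along that axis and decays along it, so it is 0, and f vanishes almost everywhere by the
  fundamental lemma.\<close>

lemma zero_weak_gradient_imp_AE_0:
  fixes f :: "real^'n::finite \<Rightarrow> complex"
  assumes fg: "has_weak_gradient f g" and g0: "AE x in lebesgue. g x = 0"
    and f [measurable]: "f \<in> borel_measurable borel" and f2: "integrable lborel (\<lambda>x. (norm (f x))\<^sup>2)"
  shows "AE x in lborel. f x = 0"
proof (rule convolve_mollifier_seq_eq_0_imp_AE[OF _ f])
  show lf: "locally_integrable f" using fg by (simp add: has_weak_gradient_def)
  fix n and x :: "real^'n"
  \<comment> \<open>Any single coordinate direction will do.\<close>
  define i :: 'n where "i = undefined"
  note k = mollifier_mollifier_seq[of n, where ?'n='n]
  have shift: "convolve (mollifier_seq n) f (x + h *\<^sub>R axis i 1) = convolve (mollifier_seq n) f x" for h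
  proof -
    obtain \<psi> where \<psi>: "test_fun \<psi>"
      "\<And>y. partial_deriv i \<psi> y = mollifier_seq n (x + h *\<^sub>R axis i 1 - y) - mollifier_seq n (x - y)"
      using mollifier_seq_diff_partial_deriv[of i n x h] by blast
    note [measurable] = mollifier_borel[OF k]
    note int = integrable_convolve_square(2)[OF k f f2]
    have "convolve (mollifier_seq n) f (x + h *\<^sub>R axis i 1) - convolve (mollifier_seq n) f x
      = (\<integral>y. partial_deriv i \<psi> y *\<^sub>R f y \<partial>lborel)"
      unfolding convolve_def \<psi>(2) scaleR_left_diff_distrib
      by (rule Bochner_Integration.integral_diff[OF int int, symmetric])
    also have "\<dots> = (LINT y|lebesgue. partial_deriv i \<psi> y *\<^sub>R f y)"
      unfolding \<psi>(2) by (rule integral_completion[symmetric]) measurable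
    also have "\<dots> = - (LINT y|lebesgue. \<psi> y *\<^sub>R (g y $ i))"
      using fg \<psi>(1) by (simp add: has_weak_gradient_def)
    also have "(LINT y|lebesgue. \<psi> y *\<^sub>R (g y $ i)) = 0"
      using g0 by (intro integral_eq_zero_AE) (auto elim!: eventually_mono)
    finally show ?thesis by simp
  qed
  have "filterlim (\<lambda>m. norm (x + real m *\<^sub>R axis i 1)) at_top sequentially"
  proof (rule filterlim_at_top_mono)
    show "filterlim (\<lambda>m. - norm x + real m) at_top sequentially"
      by (rule filterlim_tendsto_add_at_top[OF tendsto_const filterlim_real_sequentially])
    show "\<forall>\<^sub>F m in sequentially. - norm x + real m \<le> norm (x + real m *\<^sub>R axis i 1)"
    proof (rule always_eventually, rule allI)
      fix m
      have "real m = norm (real m *\<^sub>R axis i 1 :: real^'n)" by (simp add: norm_axis_1)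
      then show "- norm x + real m \<le> norm (x + real m *\<^sub>R axis i 1)"
        using norm_triangle_ineq2[of "real m *\<^sub>R axis i 1" "- x"] by (simp add: add.commute)
    qed
  qed
  from convolve_decay[OF k f f2 this] show "convolve (mollifier_seq n) f x = 0"
    by (simp add: shift LIMSEQ_const_iff)
qed

section \<open>Amplitude and dilation scaling\<close>

lemma square_integrable_scale:
  fixes f :: "'a::euclidean_space \<Rightarrow> 'b::euclidean_space"
  assumes f: "square_integrable f" and b: "0 < b"
  shows "square_integrable (\<lambda>x. a *\<^sub>R f (b *\<^sub>R x))"
proof -
  have m: "f \<in> borel_measurable lebesgue" and f2: "integrable lebesgue (\<lambda>x. (norm (f x))\<^sup>2)"
    using f by (auto simp: square_integrable_def)
  have [measurable]: "(\<lambda>x. f (b *\<^sub>R x)) \<in> borel_measurable lebesgue"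
    using borel_measurable_lebesgue_affine[OF _ m, of b 0] b by simp
  have "integrable lebesgue (\<lambda>x. (norm (f (b *\<^sub>R x)))\<^sup>2)"
    using integrable_lebesgue_affine_iff[of b "\<lambda>x. (norm (f x))\<^sup>2" 0] b m f2 by simp
  then show ?thesis
    by (auto simp: square_integrable_def power_mult_distrib)
qed

lemma has_weak_gradient_scale:
  fixes f :: "real^'n::finite \<Rightarrow> complex"
  assumes fg: "has_weak_gradient f g" and f: "square_integrable f" and g: "square_integrable g" and b: "0 < b"
  shows "has_weak_gradient (\<lambda>x. a *\<^sub>R f (b *\<^sub>R x)) (\<lambda>x. (a * b) *\<^sub>R g (b *\<^sub>R x))"
  unfolding has_weak_gradient_def
proof (intro conjI allI impI square_integrable_imp_locally_integrable square_integrable_scale f g b)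
  fix \<psi> :: "real^'n \<Rightarrow> real" and i assume \<psi>: "test_fun \<psi>"
  \<comment> \<open>The inverse dilation is put on the test function. Substituting b x in both sides
    of the identity for \<open>?\<theta>\<close> yields the same Jacobian, which cancels, and leaves
    the factor 1/b from differentiating \<open>?\<theta>\<close>.\<close>
  let ?\<theta> = "\<lambda>x. \<psi> (inverse b *\<^sub>R x)"
  have \<theta>: "test_fun ?\<theta>" "partial_deriv i ?\<theta> = (\<lambda>x. inverse b * partial_deriv i \<psi> (inverse b *\<^sub>R x))"
    using test_fun_affine[OF \<psi>, where c="inverse b" and t=0] b by simp_all
  have [measurable]: "f \<in> borel_measurable lebesgue" "g \<in> borel_measurable lebesgue"
    using f g by (auto simp: square_integrable_def)
  have [measurable]: "?\<theta> \<in> borel_measurable lebesgue" "partial_deriv i ?\<theta> \<in> borel_measurable lebesgue"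
    using test_fun_continuous[OF \<theta>(1)] by (simp_all add: measurable_completion borel_measurable_continuous_onI)
  have [measurable]: "(\<lambda>x. g x $ i) \<in> borel_measurable lebesgue"
    by (rule measurable_compose[OF \<open>g \<in> borel_measurable lebesgue\<close> borel_measurable_continuous_onI])
       (intro continuous_intros)
  have 1: "(LINT x|lebesgue. partial_deriv i ?\<theta> x *\<^sub>R f x)
      = b ^ DIM(real^'n) *\<^sub>R (inverse b *\<^sub>R (LINT x|lebesgue. partial_deriv i \<psi> x *\<^sub>R f (b *\<^sub>R x)))"
  proof -
    have "(\<lambda>x. partial_deriv i ?\<theta> x *\<^sub>R f x) \<in> borel_measurable lebesgue" by measurable
    moreover have "(LINT x|lebesgue. (inverse b * partial_deriv i \<psi> x) *\<^sub>R f (b *\<^sub>R x))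
        = inverse b *\<^sub>R (LINT x|lebesgue. partial_deriv i \<psi> x *\<^sub>R f (b *\<^sub>R x))"
      by (simp only: scaleR_scaleR[symmetric] integral_scaleR_right)
    ultimately show ?thesis
      using integral_lebesgue_affine[of b "\<lambda>x. partial_deriv i ?\<theta> x *\<^sub>R f x" 0] b by (simp add: \<theta>(2))
  qed
  have 2: "(LINT x|lebesgue. ?\<theta> x *\<^sub>R (g x $ i))
      = b ^ DIM(real^'n) *\<^sub>R (LINT x|lebesgue. \<psi> x *\<^sub>R (g (b *\<^sub>R x) $ i))"
    using b by (subst integral_lebesgue_affine[of b _ 0]) simp_all
  have "(LINT x|lebesgue. partial_deriv i ?\<theta> x *\<^sub>R f x) = - (LINT x|lebesgue. ?\<theta> x *\<^sub>R (g x $ i))"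
    using fg \<theta>(1) unfolding has_weak_gradient_def by blast
  then have *: "inverse b *\<^sub>R (LINT x|lebesgue. partial_deriv i \<psi> x *\<^sub>R f (b *\<^sub>R x))
      = - (LINT x|lebesgue. \<psi> x *\<^sub>R (g (b *\<^sub>R x) $ i))"
    unfolding 1 2 scaleR_minus_right[symmetric] using b by (simp only: scaleR_cancel_left) auto
  have "(LINT x|lebesgue. partial_deriv i \<psi> x *\<^sub>R f (b *\<^sub>R x))
      = b *\<^sub>R inverse b *\<^sub>R (LINT x|lebesgue. partial_deriv i \<psi> x *\<^sub>R f (b *\<^sub>R x))"
    using b by simp
  also have "\<dots> = b *\<^sub>R - (LINT x|lebesgue. \<psi> x *\<^sub>R (g (b *\<^sub>R x) $ i))"
    unfolding * ..
  finally have **: "(LINT x|lebesgue. partial_deriv i \<psi> x *\<^sub>R f (b *\<^sub>R x))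
      = b *\<^sub>R - (LINT x|lebesgue. \<psi> x *\<^sub>R (g (b *\<^sub>R x) $ i))" .
  have "(\<lambda>x. partial_deriv i \<psi> x *\<^sub>R a *\<^sub>R f (b *\<^sub>R x)) = (\<lambda>x. a *\<^sub>R (partial_deriv i \<psi> x *\<^sub>R f (b *\<^sub>R x)))"
    "(\<lambda>x. \<psi> x *\<^sub>R (((a * b) *\<^sub>R g (b *\<^sub>R x)) $ i)) = (\<lambda>x. a *\<^sub>R b *\<^sub>R (\<psi> x *\<^sub>R (g (b *\<^sub>R x) $ i)))"
    by (simp_all add: fun_eq_iff mult_ac)
  then show "(LINT x|lebesgue. partial_deriv i \<psi> x *\<^sub>R a *\<^sub>R f (b *\<^sub>R x))
      = - (LINT x|lebesgue. \<psi> x *\<^sub>R (((a * b) *\<^sub>R g (b *\<^sub>R x)) $ i))"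
    by (simp only: integral_scaleR_right ** scaleR_minus_right)
qed

section \<open>The threshold level\<close>

abbreviation gradient_int :: "(real^4 \<Rightarrow> complex) \<Rightarrow> real" where
  "gradient_int \<phi> \<equiv> (LINT x|lebesgue. (norm (weak_gradient \<phi> x))\<^sup>2)"

abbreviation quartic_int :: "(real^4 \<Rightarrow> complex) \<Rightarrow> real" where
  "quartic_int \<phi> \<equiv> (LINT x|lebesgue. norm (\<phi> x) ^ 4)"

abbreviation subcritical_int :: "(real^4 \<Rightarrow> complex) \<Rightarrow> real" where
  "subcritical_int \<phi> \<equiv> (LINT x|lebesgue. norm (\<phi> x) powr (10/3))"

text \<open>The class on which the energy and \<open>K_fun\<close> split into the three integrals.
  Integrability of the power 10/3 follows by interpolation between 2 and 4.\<close>

definition H1_L4 :: "(real^4 \<Rightarrow> complex) set" where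
  "H1_L4 = {\<phi> \<in> H1. integrable lebesgue (\<lambda>x. norm (\<phi> x) ^ 4)}"

lemma H1_weak_gradient:
  assumes "f \<in> H1"
  shows "has_weak_gradient f (weak_gradient f)" "square_integrable (weak_gradient f)" "square_integrable f"
proof -
  obtain g where g: "has_weak_gradient f g" "square_integrable g" and f: "square_integrable f"
    using assms by (auto simp: H1_def)
  show w: "has_weak_gradient f (weak_gradient f)"
    unfolding weak_gradient_def using g(1) by (rule someI[where P="has_weak_gradient f"])
  show "square_integrable (weak_gradient f)"
    using w by (intro square_integrable_cong_AE[OF g(2) has_weak_gradient_unique[OF g(1) w]])
      (auto simp: has_weak_gradient_def locally_integrable_borel_measurable)
  show "square_integrable f" by (rule f)
qed

lemma H1_I:
  assumes "has_weak_gradient f g" "square_integrable f" "square_integrable g"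
  shows "f \<in> H1" "(LINT x|lebesgue. (norm (weak_gradient f x))\<^sup>2) = (LINT x|lebesgue. (norm (g x))\<^sup>2)"
proof -
  show f: "f \<in> H1" using assms by (auto simp: H1_def)
  have [measurable]: "weak_gradient f \<in> borel_measurable lebesgue" "g \<in> borel_measurable lebesgue"
    using H1_weak_gradient(2)[OF f] assms by (auto simp: square_integrable_def)
  show "(LINT x|lebesgue. (norm (weak_gradient f x))\<^sup>2) = (LINT x|lebesgue. (norm (g x))\<^sup>2)"
    using has_weak_gradient_unique[OF H1_weak_gradient(1)[OF f] assms(1)]
    by (intro integral_cong_AE) (auto elim!: eventually_mono)
qed

lemma powr_ten_thirds_le: "t powr (10/3) \<le> t\<^sup>2 + t ^ 4" if "0 \<le> t" for t :: real
proof (cases "t \<le> 1")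
  case True
  have "t powr (10/3) \<le> t powr 2"
    using True that by (intro powr_mono') auto
  also have "\<dots> = t\<^sup>2" using that by (simp add: powr_numeral)
  finally show ?thesis using that by (simp add: add_increasing2)
next
  case False
  then have "t powr (10/3) \<le> t powr 4"
    by (intro powr_mono) auto
  also have "\<dots> = t ^ 4" using that by (simp add: powr_numeral)
  finally show ?thesis by (simp add: add_increasing)
qed

lemma H1_L4_integrable_powr:
  assumes "\<phi> \<in> H1_L4"
  shows "integrable lebesgue (\<lambda>x. norm (\<phi> x) powr (10/3))"
proof -
  have [measurable]: "\<phi> \<in> borel_measurable lebesgue"
    using assms by (auto simp: H1_L4_def H1_def square_integrable_def)
  show ?thesis
  proof (rule Bochner_Integration.integrable_bound)
    show "integrable lebesgue (\<lambda>x. (norm (\<phi> x))\<^sup>2 + norm (\<phi> x) ^ 4)"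
      using assms by (auto simp: H1_L4_def H1_def square_integrable_def)
    show "AE x in lebesgue. norm (norm (\<phi> x) powr (10/3)) \<le> norm ((norm (\<phi> x))\<^sup>2 + norm (\<phi> x) ^ 4)"
      using powr_ten_thirds_le[of "norm (\<phi> _)"] by auto
  qed measurable
qed

lemma energy_K_fun_H1_L4:
  assumes \<phi>: "\<phi> \<in> H1_L4"
  shows "energy \<phi> = gradient_int \<phi> / 2 - quartic_int \<phi> / 4 + 3/10 * subcritical_int \<phi>"
    and "K_fun \<alpha> \<beta> \<phi> = (\<alpha> + \<beta>) * (gradient_int \<phi> - quartic_int \<phi>) + (\<alpha> + 6/5 * \<beta>) * subcritical_int \<phi>"
proof -
  have i: "integrable lebesgue (\<lambda>x. (norm (weak_gradient \<phi> x))\<^sup>2)" "integrable lebesgue (\<lambda>x. norm (\<phi> x) ^ 4)"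
    using \<phi> H1_weak_gradient(2)[of \<phi>] by (auto simp: H1_L4_def square_integrable_def)
  note i3 = H1_L4_integrable_powr[OF \<phi>]
  show "energy \<phi> = gradient_int \<phi> / 2 - quartic_int \<phi> / 4 + 3/10 * subcritical_int \<phi>"
    unfolding energy_def using i i3 by simp
  show "K_fun \<alpha> \<beta> \<phi> = (\<alpha> + \<beta>) * (gradient_int \<phi> - quartic_int \<phi>) + (\<alpha> + 6/5 * \<beta>) * subcritical_int \<phi>"
    unfolding K_fun_def using i by simp
qed

text \<open>The point is that the quartic and the 10/3 terms have opposite signs, so a cancellation
  that makes the integrand integrable must be ruled out. For large values of
  \<open>norm (\<phi> x)\<close> the quartic term dominates, and for bounded values the 10/3 term is
  controlled by the square.\<close>

lemma energy_eq_0: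
  assumes \<phi>: "\<phi> \<in> H1" "\<phi> \<notin> H1_L4"
  shows "energy \<phi> = 0"
proof -
  let ?e = "\<lambda>x. 1/2 * (norm (weak_gradient \<phi> x))\<^sup>2 - 1/4 * norm (\<phi> x) ^ 4 + 3/10 * norm (\<phi> x) powr (10/3)"
  have m [measurable]: "\<phi> \<in> borel_measurable lebesgue"
    and i2: "integrable lebesgue (\<lambda>x. (norm (\<phi> x))\<^sup>2)"
    using \<phi> by (auto simp: H1_def square_integrable_def)
  have ig: "integrable lebesgue (\<lambda>x. (norm (weak_gradient \<phi> x))\<^sup>2)"
    using \<phi> H1_weak_gradient(2)[of \<phi>] by (auto simp: square_integrable_def)
  have "\<not> integrable lebesgue ?e"
  proof
    assume "integrable lebesgue ?e"
    \<comment> \<open>The values are split at t = 8 = 2^3, which makes both powers explicit: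
      t^(10/3) is at most 16 t^2 below 8 and at most t^4/4 above. The 5 exceeds 3/10 * 16, and the
      outer 8 works because 1/4 - 3/10 * 1/4 is at least 1/8.\<close>
    from integrable_mult_right[OF Bochner_Integration.integrable_add[OF
        Bochner_Integration.integrable_diff[OF integrable_mult_right[OF ig, of "1/2"] this]
        integrable_mult_right[OF i2, of 5]], of 8]
    have i: "integrable lebesgue (\<lambda>x. 8 * (1/2 * (norm (weak_gradient \<phi> x))\<^sup>2 - ?e x + 5 * (norm (\<phi> x))\<^sup>2))" .
    have lin: "q \<le> 8 * (1/4 * q - 3/10 * p + 5 * r)" if "p \<le> 16 * r \<or> p \<le> q * (1/4)" "0 \<le> q" "0 \<le> r"
      for p q r :: real
      using that by (auto simp: field_simps)
    have "t ^ 4 \<le> 8 * (1/4 * t ^ 4 - 3/10 * t powr (10/3) + 5 * t\<^sup>2)" if t: "0 \<le> t" for t :: real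
    proof (cases "t \<le> 8")
      case True
      have "t powr (4/3) \<le> 8 powr (4/3)" using True t by (intro powr_mono2) auto
      also have "(8::real) powr (4/3) = (2 powr 3) powr (4/3)" by simp
      also have "\<dots> = 16" by (subst powr_powr) simp
      finally have "t\<^sup>2 * t powr (4/3) \<le> t\<^sup>2 * 16"
        by (intro mult_left_mono) auto
      moreover have "t powr (10/3) = t\<^sup>2 * t powr (4/3)"
        using t powr_add[of t 2 "4/3"] by simp
      ultimately have "t powr (10/3) \<le> 16 * t\<^sup>2" by simp
      then show ?thesis using zero_le_power[OF t] by (intro lin) auto
    next
      case False
      have "t powr (- (2/3)) \<le> 8 powr (- (2/3))" using False by (intro powr_mono2') auto
      also have "(8::real) powr (- (2/3)) = (2 powr 3) powr (- (2/3))" by simp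
      also have "\<dots> = 1/4" by (subst powr_powr) (simp add: powr_minus)
      finally have "t ^ 4 * t powr (- (2/3)) \<le> t ^ 4 * (1/4)"
        using t by (intro mult_left_mono) auto
      moreover have "t powr (10/3) = t ^ 4 * t powr (- (2/3))"
        using t powr_add[of t 4 "- (2/3)"] by simp
      ultimately have "t powr (10/3) \<le> t ^ 4 * (1/4)" by simp
      then show ?thesis using zero_le_power[OF t] by (intro lin) auto
    qed
    note le = this
    have "integrable lebesgue (\<lambda>x. norm (\<phi> x) ^ 4)"
    proof (rule Bochner_Integration.integrable_bound[OF i])
      show "AE x in lebesgue. norm (norm (\<phi> x) ^ 4)
          \<le> norm (8 * (1/2 * (norm (weak_gradient \<phi> x))\<^sup>2 - ?e x + 5 * (norm (\<phi> x))\<^sup>2))"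
      proof (rule AE_I2)
        fix x
        have "norm (\<phi> x) ^ 4 \<le> 8 * (1/2 * (norm (weak_gradient \<phi> x))\<^sup>2 - ?e x + 5 * (norm (\<phi> x))\<^sup>2)"
          using le[of "norm (\<phi> x)"] by simp
        then have "norm (\<phi> x) ^ 4 \<le> \<bar>8 * (1/2 * (norm (weak_gradient \<phi> x))\<^sup>2 - ?e x + 5 * (norm (\<phi> x))\<^sup>2)\<bar>"
          by (rule order_trans[OF _ abs_ge_self])
        then show "norm (norm (\<phi> x) ^ 4)
            \<le> norm (8 * (1/2 * (norm (weak_gradient \<phi> x))\<^sup>2 - ?e x + 5 * (norm (\<phi> x))\<^sup>2))"
          by (simp only: real_norm_def power_abs abs_norm_cancel)
      qed
    qed simp
    with \<phi> show False by (simp add: H1_L4_def)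
  qed
  then show ?thesis
    unfolding energy_def by (rule not_integrable_integral_eq)
qed

lemma AE_0_iff_integral_powr:
  fixes f :: "'a \<Rightarrow> 'b::real_normed_vector" and p :: nat
  assumes "integrable M (\<lambda>x. norm (f x) ^ p)" "0 < p"
  shows "(LINT x|M. norm (f x) ^ p) = 0 \<longleftrightarrow> (AE x in M. f x = 0)"
proof -
  have "(LINT x|M. norm (f x) ^ p) = 0 \<longleftrightarrow> (AE x in M. norm (f x) ^ p = 0)"
    by (rule integral_nonneg_eq_0_iff_AE[OF assms(1)]) (intro AE_I2 zero_le_power norm_ge_zero)
  also have "(\<lambda>x. norm (f x) ^ p = 0) = (\<lambda>x. f x = 0)"
    using assms(2) by simp
  finally show ?thesis .
qed

text \<open>The gradient integral is the substantial case: if it were 0, a Borel representative of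
  \<open>\<phi>\<close> would have vanishing weak gradient and so be zero almost everywhere.\<close>

lemma H1_L4_pos:
  assumes \<phi>: "\<phi> \<in> H1_L4" and n0: "\<not> (AE x in lebesgue. \<phi> x = 0)"
  shows "0 < gradient_int \<phi>" "0 < quartic_int \<phi>" "0 < subcritical_int \<phi>"
proof -
  have H: "\<phi> \<in> H1" and i4: "integrable lebesgue (\<lambda>x. norm (\<phi> x) ^ 4)"
    using \<phi> by (auto simp: H1_L4_def)
  note w = H1_weak_gradient[OF H]
  have "quartic_int \<phi> \<noteq> 0"
    using AE_0_iff_integral_powr[OF i4] n0 by simp
  moreover have "0 \<le> quartic_int \<phi>" by simp
  ultimately show "0 < quartic_int \<phi>" by linarith
  have "subcritical_int \<phi> \<noteq> 0"
    using n0 by (subst integral_nonneg_eq_0_iff_AE[OF H1_L4_integrable_powr[OF \<phi>]]) auto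
  moreover have "0 \<le> subcritical_int \<phi>" by simp
  ultimately show "0 < subcritical_int \<phi>" by linarith
  have "gradient_int \<phi> \<noteq> 0"
  proof
    assume "gradient_int \<phi> = 0"
    then have g0: "AE x in lebesgue. weak_gradient \<phi> x = 0"
      using AE_0_iff_integral_powr[of lebesgue "weak_gradient \<phi>" 2] w(2) by (simp add: square_integrable_def)
    obtain f where f [measurable]: "f \<in> borel_measurable borel" and ae: "AE x in lebesgue. \<phi> x = f x"
      using lebesgue_AE_eq_borel[of \<phi>] w(3) by (auto simp: square_integrable_def)
    have fl: "f \<in> borel_measurable lebesgue" using f by (simp add: measurable_completion)
    have wm: "weak_gradient \<phi> \<in> borel_measurable lebesgue" using w(2) by (simp add: square_integrable_def)
    have "square_integrable f" by (rule square_integrable_cong_AE[OF w(3) ae fl])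
    then have f2: "integrable lborel (\<lambda>x. (norm (f x))\<^sup>2)"
      by (simp add: square_integrable_def integrable_completion)
    have "has_weak_gradient f (weak_gradient \<phi>)"
      by (rule has_weak_gradient_cong_AE[OF w(1) ae fl _ wm]) simp
    then have "AE x in lborel. f x = 0"
      by (rule zero_weak_gradient_imp_AE_0[OF _ g0 f f2])
    then have "AE x in lebesgue. f x = 0" by (rule AE_completion)
    with ae have "AE x in lebesgue. \<phi> x = 0" by eventually_elim simp
    with n0 show False by simp
  qed
  moreover have "0 \<le> gradient_int \<phi>" by simp
  ultimately show "0 < gradient_int \<phi>" by linarith
qed

text \<open>The zero class is excluded from the infimum but not from \<open>K_plus\<close>, so it
  needs its own evaluation. The chosen weak gradient is zero only almost everywhere, by
  uniqueness.\<close>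

lemma energy_K_fun_AE_0:
  assumes "\<phi> \<in> H1" and 0: "AE x in lebesgue. \<phi> x = 0"
  shows "energy \<phi> = 0" "K_fun \<alpha> \<beta> \<phi> = 0"
proof -
  have m: "\<phi> \<in> borel_measurable lebesgue" using assms by (auto simp: H1_def square_integrable_def)
  have z: "has_weak_gradient (\<lambda>x. 0 :: complex) (\<lambda>x. 0 :: complex^4)"
    by (simp add: has_weak_gradient_def locally_integrable_def set_integrable_def)
  have "has_weak_gradient \<phi> (\<lambda>x. 0)"
    using 0 m by (intro has_weak_gradient_cong_AE[OF z]) (auto elim!: eventually_mono)
  from has_weak_gradient_unique[OF H1_weak_gradient(1)[OF assms(1)] this]
  have w: "AE x in lebesgue. weak_gradient \<phi> x = 0" .
  show "energy \<phi> = 0"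
    unfolding energy_def using 0 w by (intro integral_eq_zero_AE, eventually_elim) simp
  have "(LINT x|lebesgue. (norm (weak_gradient \<phi> x))\<^sup>2 - norm (\<phi> x) ^ 4) = 0"
    using 0 w by (intro integral_eq_zero_AE, eventually_elim) simp
  moreover have "subcritical_int \<phi> = 0"
    using 0 by (intro integral_eq_zero_AE, eventually_elim) simp
  ultimately show "K_fun \<alpha> \<beta> \<phi> = 0" by (simp add: K_fun_def)
qed

lemma H1_L4_scale:
  fixes s t :: real
  assumes \<phi>: "\<phi> \<in> H1_L4" and n0: "\<not> (AE x in lebesgue. \<phi> x = 0)" and st: "0 < s" "0 < t"
  obtains \<psi> where "\<psi> \<in> H1_L4" "\<not> (AE x in lebesgue. \<psi> x = 0)"
    "gradient_int \<psi> = s * gradient_int \<phi>" "quartic_int \<psi> = s\<^sup>2 * quartic_int \<phi>"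
    "subcritical_int \<psi> = t * subcritical_int \<phi>"
proof -
  \<comment> \<open>\<open>a\<close> and \<open>b\<close> solve \<open>(a / b)\<^sup>2 = s\<close> and \<open>a powr (10/3) / b ^ 4 = t\<close>.\<close>
  define b where "b = (s powr (5/3) / t) powr (3/2)"
  define a where "a = b * sqrt s"
  have b: "0 < b" and a: "0 < a" using st by (auto simp: a_def b_def)
  define \<psi> where "\<psi> x = a *\<^sub>R \<phi> (b *\<^sub>R x)" for x
  have H: "\<phi> \<in> H1" and i4: "integrable lebesgue (\<lambda>x. norm (\<phi> x) ^ 4)"
    using \<phi> by (auto simp: H1_L4_def)
  note w = H1_weak_gradient[OF H]
  have m [measurable]: "\<phi> \<in> borel_measurable lebesgue" "weak_gradient \<phi> \<in> borel_measurable lebesgue"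
    using w by (auto simp: square_integrable_def)
  have scale: "(LINT x|lebesgue. h (b *\<^sub>R x)) = (LINT x|lebesgue. h x) / b ^ 4"
    if "h \<in> borel_measurable lebesgue" for h :: "real^4 \<Rightarrow> real"
    using integral_lebesgue_affine[OF _ that, of b 0] b by simp
  have sq: "square_integrable \<psi>" "square_integrable (\<lambda>x. (a * b) *\<^sub>R weak_gradient \<phi> (b *\<^sub>R x))"
    unfolding \<psi>_def using w b by (auto intro: square_integrable_scale)
  have wg: "has_weak_gradient \<psi> (\<lambda>x. (a * b) *\<^sub>R weak_gradient \<phi> (b *\<^sub>R x))"
    unfolding \<psi>_def[abs_def] by (rule has_weak_gradient_scale[OF w(1,3,2) b])
  have G: "gradient_int \<psi> = s * gradient_int \<phi>"
  proof -
    have "gradient_int \<psi> = (LINT x|lebesgue. (a * b)\<^sup>2 * (norm (weak_gradient \<phi> (b *\<^sub>R x)))\<^sup>2)"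
      using H1_I(2)[OF wg sq] a b by (simp add: power_mult_distrib abs_mult)
    also have "\<dots> = (a * b)\<^sup>2 * (gradient_int \<phi> / b ^ 4)"
      using scale[of "\<lambda>x. (norm (weak_gradient \<phi> x))\<^sup>2"] by simp
    also have "\<dots> = s * gradient_int \<phi>"
      using b st by (simp add: a_def power2_eq_square power4_eq_xxxx)
    finally show ?thesis .
  qed
  have P: "quartic_int \<psi> = s\<^sup>2 * quartic_int \<phi>"
  proof -
    have "quartic_int \<psi> = (LINT x|lebesgue. a ^ 4 * norm (\<phi> (b *\<^sub>R x)) ^ 4)"
      using a by (simp add: \<psi>_def power_mult_distrib)
    also have "\<dots> = a ^ 4 * (quartic_int \<phi> / b ^ 4)"
      using scale[of "\<lambda>x. norm (\<phi> x) ^ 4"] by simp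
    also have "\<dots> = s\<^sup>2 * quartic_int \<phi>"
      using b st by (simp add: a_def power2_eq_square power4_eq_xxxx)
    finally show ?thesis .
  qed
  have Q: "subcritical_int \<psi> = t * subcritical_int \<phi>"
  proof -
    have "subcritical_int \<psi> = (LINT x|lebesgue. a powr (10/3) * norm (\<phi> (b *\<^sub>R x)) powr (10/3))"
      using a by (simp add: \<psi>_def powr_mult)
    also have "\<dots> = a powr (10/3) * (subcritical_int \<phi> / b ^ 4)"
      using scale[of "\<lambda>x. norm (\<phi> x) powr (10/3)"] by simp
    also have "a powr (10/3) = b powr (10/3) * s powr (5/3)"
      using b st by (simp add: a_def powr_mult powr_powr flip: powr_half_sqrt)
    also have "b powr (10/3) = b ^ 4 * b powr (- (2/3))"
      using b powr_add[of b 4 "- (2/3)"] by simp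
    also have "b powr (- (2/3)) = t / s powr (5/3)"
      using st by (simp add: b_def powr_powr powr_minus)
    finally show ?thesis using b st by simp
  qed
  have i: "integrable lebesgue (\<lambda>x. norm (\<psi> x) ^ 4)"
    using integrable_lebesgue_affine_iff[of b "\<lambda>x. norm (\<phi> x) ^ 4" 0] b i4
    by (simp add: \<psi>_def power_mult_distrib)
  then have good: "\<psi> \<in> H1_L4"
    using H1_I(1)[OF wg sq] by (simp add: H1_L4_def)
  \<comment> \<open>The scaled quartic integral is positive, so nontriviality is inherited without
    transporting null sets under the dilation.\<close>
  have "quartic_int \<psi> \<noteq> 0"
    using P H1_L4_pos(2)[OF \<phi> n0] st by simp
  then have "\<not> (AE x in lebesgue. \<psi> x = 0)"
    using AE_0_iff_integral_powr[OF i] by simp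
  with that good G P Q show ?thesis by blast
qed

text \<open>Extends a Sobolev inequality from \<open>H1_L4\<close> to \<open>H1\<close>. Mollified
  functions lie in \<open>H1_L4\<close> and their gradient integrals do not exceed that of
  \<open>\<phi>\<close>, so their quartic integrals share the bound D, which Fatou's lemma passes to
  the limit.\<close>

lemma quartic_int_bound_imp_H1_L4:
  assumes \<phi>: "\<phi> \<in> H1"
    and C: "\<And>\<psi>. \<psi> \<in> H1_L4 \<Longrightarrow> \<not> (AE x in lebesgue. \<psi> x = 0) \<Longrightarrow> quartic_int \<psi> \<le> C * (gradient_int \<psi>)\<^sup>2"
    and C0: "0 \<le> C"
  shows "\<phi> \<in> H1_L4"
proof -
  note w = H1_weak_gradient[OF \<phi>]
  have m: "\<phi> \<in> borel_measurable lebesgue" "weak_gradient \<phi> \<in> borel_measurable lebesgue"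
    using w by (auto simp: square_integrable_def)
  obtain f where f [measurable]: "f \<in> borel_measurable borel" and aef: "AE x in lebesgue. \<phi> x = f x"
    using lebesgue_AE_eq_borel[OF m(1)] by auto
  obtain g where g [measurable]: "g \<in> borel_measurable borel" and aeg: "AE x in lebesgue. weak_gradient \<phi> x = g x"
    using lebesgue_AE_eq_borel[OF m(2)] by auto
  have ml: "f \<in> borel_measurable lebesgue" "g \<in> borel_measurable lebesgue"
    using f g by (simp_all add: measurable_completion)
  have sq: "square_integrable f" "square_integrable g"
    using square_integrable_cong_AE[OF w(3) aef ml(1)] square_integrable_cong_AE[OF w(2) aeg ml(2)] by auto
  have f2: "integrable lborel (\<lambda>x. (norm (f x))\<^sup>2)" and g2: "integrable lborel (\<lambda>x. (norm (g x))\<^sup>2)"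
    using sq by (simp_all add: square_integrable_def integrable_completion)
  have fg: "has_weak_gradient f g"
    by (rule has_weak_gradient_cong_AE[OF w(1) aef ml(1) aeg ml(2)])
  define D where "D = C * (LINT x|lebesgue. (norm (g x))\<^sup>2)\<^sup>2"
  have u: "(\<integral>\<^sup>+x. norm (convolve (mollifier_seq n) f x) ^ 4 \<partial>lborel) \<le> ennreal D" for n
  proof -
    note k = mollifier_mollifier_seq[of n, where ?'n=4]
    let ?u = "convolve (mollifier_seq n) f" and ?v = "convolve (mollifier_seq n) g"
    have um [measurable]: "?u \<in> borel_measurable borel" "?v \<in> borel_measurable borel"
      using borel_measurable_convolve[OF k f] borel_measurable_convolve[OF k g] .
    note uv = convolve_has_weak_gradient[OF k fg f f2 g g2]
    note u2 = convolve_square_integrable[OF k f f2] and v2 = convolve_square_integrable[OF k g g2]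
    obtain B where B: "\<And>x. (norm (?u x))\<^sup>2 \<le> B"
      using convolve_bounded[OF k f f2] by blast
    have "integrable lborel (\<lambda>x. norm (?u x) ^ 4)"
    proof (rule Bochner_Integration.integrable_bound)
      show "integrable lborel (\<lambda>x. B * (norm (?u x))\<^sup>2)" using u2(1) by simp
      have "norm (?u x) ^ 4 \<le> B * (norm (?u x))\<^sup>2" for x
        using mult_right_mono[OF B[of x], of "(norm (?u x))\<^sup>2"]
        by (simp add: power2_eq_square power4_eq_xxxx mult.assoc)
      then show "AE x in lborel. norm (norm (?u x) ^ 4) \<le> norm (B * (norm (?u x))\<^sup>2)"
        by (auto intro: order_trans[OF _ abs_ge_self])
    qed simp
    then have i4: "integrable lborel (\<lambda>x. norm (?u x) ^ 4)" "integrable lebesgue (\<lambda>x. norm (?u x) ^ 4)"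
      by (simp_all add: integrable_completion)
    have "gradient_int ?u = (LINT x|lebesgue. (norm (?v x))\<^sup>2)"
      by (rule H1_I(2)[OF uv])
    also have "\<dots> \<le> (LINT x|lebesgue. (norm (g x))\<^sup>2)"
      using v2(2) by (simp add: integral_completion)
    finally have G: "gradient_int ?u \<le> (LINT x|lebesgue. (norm (g x))\<^sup>2)" .
    have "quartic_int ?u \<le> D"
    proof (cases "AE x in lebesgue. ?u x = 0")
      case True
      then have "quartic_int ?u = 0" using AE_0_iff_integral_powr[OF i4(2)] by simp
      then show ?thesis using C0 by (simp add: D_def)
    next
      case False
      have "?u \<in> H1_L4" using H1_I(1)[OF uv] i4(2) by (simp add: H1_L4_def)
      from C[OF this False] have "quartic_int ?u \<le> C * (gradient_int ?u)\<^sup>2" .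
      also have "\<dots> \<le> D"
        unfolding D_def using G C0 by (intro mult_left_mono power_mono) auto
      finally show ?thesis .
    qed
    then have "(\<integral>x. norm (?u x) ^ 4 \<partial>lborel) \<le> D"
      by (simp add: integral_completion)
    then show ?thesis
      by (subst nn_integral_eq_integral[OF i4(1)]) (auto intro: ennreal_leI)
  qed
  \<comment> \<open>The convergent subsequence may depend on N, but D does not. Radius
    \<open>Suc N\<close> is taken because convergence is available only on the ball smaller by
    1.\<close>
  have ball: "(\<integral>\<^sup>+x. indicator (cball 0 (real N)) x * ennreal (norm (f x) ^ 4) \<partial>lborel) \<le> ennreal D" for N
  proof -
    obtain s where s: "AE x in lborel. norm x \<le> real (Suc N) - 1 \<longrightarrow>
        (\<lambda>n. convolve (mollifier_seq (s n)) f x) \<longlonglongrightarrow> f x"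
      using convolve_mollifier_seq_AE[OF f integrable_lborel_cball[OF square_integrable_imp_locally_integrable[OF sq(1)] f], of "real (Suc N)"]
      by auto
    have um [measurable]: "convolve (mollifier_seq n) f \<in> borel_measurable borel" for n
      by (rule borel_measurable_convolve[OF mollifier_mollifier_seq f])
    have "(\<integral>\<^sup>+x. indicator (cball 0 (real N)) x * ennreal (norm (f x) ^ 4) \<partial>lborel)
       \<le> (\<integral>\<^sup>+x. liminf (\<lambda>n. ennreal (norm (convolve (mollifier_seq (s n)) f x) ^ 4)) \<partial>lborel)"
    proof (rule nn_integral_mono_AE, use s in eventually_elim)
      fix x
      assume lim: "norm x \<le> real (Suc N) - 1 \<longrightarrow> (\<lambda>n. convolve (mollifier_seq (s n)) f x) \<longlonglongrightarrow> f x"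
      show "indicator (cball 0 (real N)) x * ennreal (norm (f x) ^ 4)
        \<le> liminf (\<lambda>n. ennreal (norm (convolve (mollifier_seq (s n)) f x) ^ 4))"
      proof (cases "norm x \<le> real N")
        case True
        then have "(\<lambda>n. convolve (mollifier_seq (s n)) f x) \<longlonglongrightarrow> f x" using lim by simp
        then have "(\<lambda>n. ennreal (norm (convolve (mollifier_seq (s n)) f x) ^ 4)) \<longlonglongrightarrow> ennreal (norm (f x) ^ 4)"
          by (intro tendsto_ennrealI tendsto_power tendsto_norm)
        then have "liminf (\<lambda>n. ennreal (norm (convolve (mollifier_seq (s n)) f x) ^ 4)) = ennreal (norm (f x) ^ 4)"
          by (intro lim_imp_Liminf) auto
        then show ?thesis using True by simp
      qed simp
    qed
    also have "\<dots> \<le> liminf (\<lambda>n. \<integral>\<^sup>+x. norm (convolve (mollifier_seq (s n)) f x) ^ 4 \<partial>lborel)"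
      by (rule nn_integral_liminf) measurable
    also have "\<dots> \<le> liminf (\<lambda>n. ennreal D)"
      by (intro Liminf_mono always_eventually allI u)
    also have "\<dots> = ennreal D" by (simp add: Liminf_const)
    finally show ?thesis .
  qed
  \<comment> \<open>A second use of Fatou's lemma, now along balls exhausting the space, removes the
    restriction to a ball.\<close>
  have "(\<integral>\<^sup>+x. norm (f x) ^ 4 \<partial>lborel)
      \<le> (\<integral>\<^sup>+x. liminf (\<lambda>N. indicator (cball 0 (real N)) x * ennreal (norm (f x) ^ 4)) \<partial>lborel)"
  proof (rule nn_integral_mono)
    fix x :: "real^4"
    obtain N0 where N0: "norm x \<le> real N0" using real_arch_simple by blast
    have "\<forall>\<^sub>F N in sequentially. ennreal (norm (f x) ^ 4) \<le> indicator (cball 0 (real N)) x * ennreal (norm (f x) ^ 4)"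
      using eventually_ge_at_top[of N0] by eventually_elim (use N0 in auto)
    then show "ennreal (norm (f x) ^ 4) \<le> liminf (\<lambda>N. indicator (cball 0 (real N)) x * ennreal (norm (f x) ^ 4))"
      by (rule Liminf_bounded)
  qed
  also have "\<dots> \<le> liminf (\<lambda>N. \<integral>\<^sup>+x. indicator (cball 0 (real N)) x * ennreal (norm (f x) ^ 4) \<partial>lborel)"
    by (rule nn_integral_liminf) (intro borel_measurable_times_ennreal borel_measurable_indicator; simp)
  also have "\<dots> \<le> liminf (\<lambda>n. ennreal D)"
    by (intro Liminf_mono always_eventually allI ball)
  also have "\<dots> < \<infinity>" by (simp add: Liminf_const)
  finally have "integrable lborel (\<lambda>x. norm (f x) ^ 4)"
    by (intro integrableI_bounded) simp_all
  then have "integrable lebesgue (\<lambda>x. norm (f x) ^ 4)"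
    by (simp add: integrable_completion)
  moreover have "AE x in lebesgue. norm (\<phi> x) ^ 4 = norm (f x) ^ 4"
    using aef by eventually_elim simp
  ultimately have "integrable lebesgue (\<lambda>x. norm (\<phi> x) ^ 4)"
    using m(1) ml(1) by (subst integrable_cong_AE[of _ _ "\<lambda>x. norm (f x) ^ 4"]) auto
  with \<phi> show ?thesis by (simp add: H1_L4_def)
qed

text \<open>The quotient is the maximum over s of \<open>s * G / 2 - s\<^sup>2 * P / 4\<close>,
  attained at s = G/P: the highest energy along a scaling ray once the 10/3 term is
  discarded.\<close>

definition sobolev_level :: ereal where
  "sobolev_level = (INF \<phi> \<in> {\<phi> \<in> H1_L4. \<not> (AE x in lebesgue. \<phi> x = 0)}.
     ereal ((gradient_int \<phi>)\<^sup>2 / (4 * quartic_int \<phi>)))"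

text \<open>If the level were positive, any q strictly between 0 and it would give the Sobolev
  inequality on \<open>H1_L4\<close> with constant \<open>1 / (4 * q)\<close>, and the preceding
  extension would put \<open>\<phi>\<close> into \<open>H1_L4\<close>.\<close>

lemma sobolev_level_le_0:
  assumes "\<phi> \<in> H1" "\<phi> \<notin> H1_L4"
  shows "sobolev_level \<le> 0"
proof (rule ccontr)
  assume "\<not> sobolev_level \<le> 0"
  then obtain q where q: "0 < ereal q" "ereal q < sobolev_level"
    using ereal_dense2[of 0 sobolev_level] by (auto simp: not_le)
  have "quartic_int \<psi> \<le> 1 / (4 * q) * (gradient_int \<psi>)\<^sup>2"
    if "\<psi> \<in> H1_L4" "\<not> (AE x in lebesgue. \<psi> x = 0)" for \<psi>
  proof -
    have "sobolev_level \<le> ereal ((gradient_int \<psi>)\<^sup>2 / (4 * quartic_int \<psi>))"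
      unfolding sobolev_level_def using that by (intro INF_lower) simp
    with q(2) have "ereal q < ereal ((gradient_int \<psi>)\<^sup>2 / (4 * quartic_int \<psi>))"
      by (rule less_le_trans)
    with H1_L4_pos(2)[OF that] q(1) show ?thesis by (simp add: field_simps)
  qed
  from quartic_int_bound_imp_H1_L4[OF assms(1) this] q(1) assms(2) show False by simp
qed

text \<open>Strict positivity comes from \<open>6 * (\<alpha> + \<beta>) = \<alpha> + (5 * \<alpha>
  + 6 * \<beta>)\<close>, a sum of two nonnegative terms that vanish together only at the excluded
  origin.\<close>

lemma Omega_signs:
  assumes "(\<alpha>, \<beta>) \<in> Omega"
  shows "0 \<le> \<alpha>" "0 < \<alpha> + \<beta>" "0 \<le> \<alpha> + 6/5 * \<beta>"
proof -
  have *: "0 \<le> \<alpha>" "0 \<le> 5 * \<alpha> + 6 * \<beta>" "\<alpha> \<noteq> 0 \<or> \<beta> \<noteq> 0"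
    using assms by (simp_all add: Omega_def)
  show "0 \<le> \<alpha>" "0 \<le> \<alpha> + 6/5 * \<beta>"
    using * by simp_all
  show "0 < \<alpha> + \<beta>"
    using * by (cases "\<alpha> = 0") auto
qed

lemma energy_ge_gradient_int:
  assumes \<Omega>: "(\<alpha>, \<beta>) \<in> Omega" and \<phi>: "\<phi> \<in> H1_L4" and K: "0 \<le> K_fun \<alpha> \<beta> \<phi>"
  shows "gradient_int \<phi> / 4 \<le> energy \<phi>"
proof -
  note s = Omega_signs[OF \<Omega>]
  \<comment> \<open>Four times the energy coefficient 3/10 is 6/5, the coefficient of
    \<open>\<beta>\<close> in \<open>K_fun\<close>. So \<open>\<beta>\<close> cancels from the
    remainder, which is nonnegative because \<open>\<alpha>\<close> is.\<close>
  have "4 * (\<alpha> + \<beta>) * (energy \<phi> - gradient_int \<phi> / 4) = K_fun \<alpha> \<beta> \<phi> + \<alpha> / 5 * subcritical_int \<phi>"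
    unfolding energy_K_fun_H1_L4[OF \<phi>] by (simp add: field_simps)
  also have "\<dots> \<ge> 0" using s K by simp
  finally show ?thesis using s(2) by (simp add: zero_le_mult_iff)
qed

lemma m_inf_eq_sobolev_level:
  assumes \<Omega>: "(\<alpha>, \<beta>) \<in> Omega"
  shows "m_inf \<alpha> \<beta> = sobolev_level"
proof (rule antisym)
  note sg = Omega_signs[OF \<Omega>]
  show "sobolev_level \<le> m_inf \<alpha> \<beta>"
    unfolding m_inf_def
  proof (rule INF_greatest)
    fix \<phi> assume "\<phi> \<in> {\<phi> \<in> H1. \<not> (AE x in lebesgue. \<phi> x = 0) \<and> K_fun \<alpha> \<beta> \<phi> = 0}"
    then have \<phi>: "\<phi> \<in> H1" "\<not> (AE x in lebesgue. \<phi> x = 0)" and K: "K_fun \<alpha> \<beta> \<phi> = 0" by auto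
    show "sobolev_level \<le> ereal (energy \<phi>)"
    proof (cases "\<phi> \<in> H1_L4")
      case True
      note p = H1_L4_pos[OF True \<phi>(2)]
      have "(\<alpha> + \<beta>) * (quartic_int \<phi> - gradient_int \<phi>) = (\<alpha> + 6/5 * \<beta>) * subcritical_int \<phi>"
        using K unfolding energy_K_fun_H1_L4[OF True] by (simp add: field_simps)
      also have "\<dots> \<ge> 0" using sg p by simp
      finally have "gradient_int \<phi> \<le> quartic_int \<phi>" using sg(2) by (simp add: zero_le_mult_iff)
      then have "gradient_int \<phi> * gradient_int \<phi> \<le> quartic_int \<phi> * gradient_int \<phi>"
        using p(1) by (intro mult_right_mono) auto
      then have "(gradient_int \<phi>)\<^sup>2 / (4 * quartic_int \<phi>) \<le> gradient_int \<phi> / 4"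
        using p by (simp add: power2_eq_square field_simps)
      also have "\<dots> \<le> energy \<phi>"
        using energy_ge_gradient_int[OF \<Omega> True] K by simp
      finally show ?thesis
        unfolding sobolev_level_def using True \<phi> by (intro INF_lower2[of \<phi>]) auto
    next
      case False
      \<comment> \<open>Here the energy is the default value 0, and the existence of such a
        \<open>\<phi>\<close> already pushes the level down to at most 0.\<close>
      then show ?thesis using sobolev_level_le_0 energy_eq_0 \<phi>(1) by (simp add: zero_ereal_def)
    qed
  qed
  show "m_inf \<alpha> \<beta> \<le> sobolev_level"
    unfolding sobolev_level_def
  proof (rule INF_greatest, rule ereal_le_epsilon2)
    fix \<phi> and e :: real assume "\<phi> \<in> {\<phi> \<in> H1_L4. \<not> (AE x in lebesgue. \<phi> x = 0)}" and e: "0 < e"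
    then have \<phi>: "\<phi> \<in> H1_L4" "\<not> (AE x in lebesgue. \<phi> x = 0)" by auto
    define G where "G = gradient_int \<phi>"
    define P where "P = quartic_int \<phi>"
    define Q where "Q = subcritical_int \<phi>"
    have pos: "0 < G" "0 < P" "0 < Q" using H1_L4_pos[OF \<phi>] by (auto simp: G_def P_def Q_def)
    have "\<exists>s t. 0 < s \<and> 0 < t \<and> (\<alpha> + \<beta>) * (s * G - s\<^sup>2 * P) + (\<alpha> + 6/5 * \<beta>) * (t * Q) = 0 \<and>
        s * G / 2 - s\<^sup>2 * P / 4 + 3/10 * (t * Q) \<le> G\<^sup>2 / (4 * P) + e"
    proof (cases "\<alpha> + 6/5 * \<beta> = 0")
      case True
      \<comment> \<open>Without the 10/3 term the constraint fixes s = G/P and leaves t free, so t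
        is chosen to make the extra energy \<open>3/10 * e\<close>.\<close>
      then show ?thesis
        using pos e by (intro exI[of _ "G / P"] exI[of _ "e / Q"]) (auto simp: field_simps power2_eq_square)
    next
      case False
      define a where "a = \<alpha> + \<beta>"
      define c where "c = \<alpha> + 6/5 * \<beta>"
      have ac: "0 < a" "0 < c" using sg False by (auto simp: a_def c_def)
      \<comment> \<open>With s = (1 + \<open>\<theta>\<close>) G/P the first part of the constraint
        is \<open>- a * s * G * \<theta>\<close>, and t is solved from it. Then tQ = M (1 +
        \<open>\<theta>\<close>) \<open>\<theta>\<close>, which is at most 2e since
        \<open>\<theta>\<close> is at most 1 and at most e/M, and 3/10 of that is below e. The other
        energy terms give G^2/(4P) times 1 - \<open>\<theta>\<close>^2.\<close>
      define M where "M = a / c * (G\<^sup>2 / P)"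
      have M: "0 < M" using ac pos by (simp add: M_def)
      define \<theta> where "\<theta> = min 1 (e / M)"
      have \<theta>: "0 < \<theta>" "\<theta> \<le> 1" "M * \<theta> \<le> e" using e M by (auto simp: \<theta>_def field_simps min_def)
      define s where "s = G / P * (1 + \<theta>)"
      define t where "t = a * s * G * \<theta> / (c * Q)"
      have st: "0 < s" "0 < t" using pos ac \<theta> by (auto simp: s_def t_def)
      have sP: "s * P = G * (1 + \<theta>)" using pos by (simp add: s_def)
      have tQ: "t * Q = M * (1 + \<theta>) * \<theta>"
        using pos ac by (simp add: t_def s_def M_def power2_eq_square field_simps)
      have s2P: "s\<^sup>2 * P = s * (G * (1 + \<theta>))" unfolding power2_eq_square mult.assoc sP ..
      have "a * (s * G - s\<^sup>2 * P) + c * (t * Q) = 0"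
        unfolding s2P using pos ac by (simp add: t_def field_simps)
      moreover have "s * G / 2 - s\<^sup>2 * P / 4 = G\<^sup>2 / (4 * P) * (1 - \<theta>\<^sup>2)"
        unfolding s2P using pos by (simp add: s_def power2_eq_square field_simps)
      moreover have "G\<^sup>2 / (4 * P) * (1 - \<theta>\<^sup>2) \<le> G\<^sup>2 / (4 * P)"
        using pos by (intro mult_left_le) auto
      moreover have "3/10 * (t * Q) \<le> e"
      proof -
        have "t * Q = M * \<theta> * (1 + \<theta>)" unfolding tQ by simp
        also have "\<dots> \<le> M * \<theta> * 2"
          using \<theta> M by (intro mult_left_mono) auto
        also have "\<dots> \<le> e * 2" using \<theta>(3) by simp
        finally show ?thesis using e by simp
      qed
      ultimately show ?thesis
        using st by (intro exI[of _ s] exI[of _ t]) (auto simp: a_def c_def)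
    qed
    then obtain s t where st: "0 < s" "0 < t"
      and K: "(\<alpha> + \<beta>) * (s * G - s\<^sup>2 * P) + (\<alpha> + 6/5 * \<beta>) * (t * Q) = 0"
      and E: "s * G / 2 - s\<^sup>2 * P / 4 + 3/10 * (t * Q) \<le> G\<^sup>2 / (4 * P) + e"
      by blast
    obtain \<psi> where \<psi>: "\<psi> \<in> H1_L4" "\<not> (AE x in lebesgue. \<psi> x = 0)"
      "gradient_int \<psi> = s * G" "quartic_int \<psi> = s\<^sup>2 * P" "subcritical_int \<psi> = t * Q"
      using H1_L4_scale[OF \<phi> st] unfolding G_def P_def Q_def by blast
    have "K_fun \<alpha> \<beta> \<psi> = 0" "energy \<psi> \<le> G\<^sup>2 / (4 * P) + e"
      using K E by (simp_all only: energy_K_fun_H1_L4[OF \<psi>(1)] \<psi>(3-5))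
    then show "m_inf \<alpha> \<beta> \<le> ereal ((gradient_int \<phi>)\<^sup>2 / (4 * quartic_int \<phi>)) + ereal e"
      unfolding m_inf_def G_def P_def using \<psi>(1,2) by (intro INF_lower2[of \<psi>]) (auto simp: H1_L4_def)
  qed
qed

text \<open>One direction suffices: exchanging the two parameter pairs gives the equivalence, and
  \<open>K_minus\<close> follows as the complement of \<open>K_plus\<close> in the common set of
  functions below the level.\<close>

lemma K_fun_nonneg_transfer:
  assumes \<Omega>: "(\<alpha>, \<beta>) \<in> Omega" and \<Omega>': "(\<alpha>', \<beta>') \<in> Omega"
    and \<phi>: "\<phi> \<in> H1" and E: "ereal (energy \<phi>) < sobolev_level" and K: "0 \<le> K_fun \<alpha> \<beta> \<phi>"
  shows "0 \<le> K_fun \<alpha>' \<beta>' \<phi>"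
proof (cases "AE x in lebesgue. \<phi> x = 0")
  case True
  then show ?thesis using energy_K_fun_AE_0(2)[OF \<phi>] by simp
next
  case False
  have good: "\<phi> \<in> H1_L4"
  proof (rule ccontr)
    assume *: "\<phi> \<notin> H1_L4"
    then show False using sobolev_level_le_0[OF \<phi> *] energy_eq_0[OF \<phi> *] E by (simp add: zero_ereal_def)
  qed
  note p = H1_L4_pos[OF good False]
  have "sobolev_level \<le> ereal ((gradient_int \<phi>)\<^sup>2 / (4 * quartic_int \<phi>))"
    unfolding sobolev_level_def using good False by (intro INF_lower) simp
  from less_le_trans[OF E this] have "energy \<phi> < (gradient_int \<phi>)\<^sup>2 / (4 * quartic_int \<phi>)"
    by simp
  with energy_ge_gradient_int[OF \<Omega> good K]
  have "gradient_int \<phi> / 4 < (gradient_int \<phi>)\<^sup>2 / (4 * quartic_int \<phi>)" by linarith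
  then have "gradient_int \<phi> * quartic_int \<phi> < gradient_int \<phi> * gradient_int \<phi>"
    using p(2) by (simp add: field_simps power2_eq_square)
  then have "quartic_int \<phi> < gradient_int \<phi>" using p(1) by simp
  then show ?thesis
    unfolding energy_K_fun_H1_L4[OF good] using Omega_signs[OF \<Omega>'] p by simp
qed

theorem proposition1p4:
  fixes \<alpha> \<beta> \<alpha>' \<beta>' :: real
  assumes "(\<alpha>, \<beta>) \<in> Omega" and "(\<alpha>', \<beta>') \<in> Omega"
  shows "K_plus \<alpha> \<beta> = K_plus \<alpha>' \<beta>' \<and> K_minus \<alpha> \<beta> = K_minus \<alpha>' \<beta>'"
proof -
  have "0 \<le> K_fun \<alpha> \<beta> \<phi> \<longleftrightarrow> 0 \<le> K_fun \<alpha>' \<beta>' \<phi>"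
    if "\<phi> \<in> H1" "ereal (energy \<phi>) < sobolev_level" for \<phi>
    using K_fun_nonneg_transfer[OF assms that] K_fun_nonneg_transfer[OF assms(2,1) that] by blast
  then show ?thesis
    unfolding K_plus_def K_minus_def m_inf_eq_sobolev_level[OF assms(1)] m_inf_eq_sobolev_level[OF assms(2)]
    by (auto simp flip: not_le)
qed

end
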